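(* Let $(\mathcal{B},\mathcal{L},\theta,\mathcal{I}_\alpha)$ be a generalized Boolean dynamical system. Let $M$ be the $C^*$-subalgebra of $C^*(\mathcal{B},\mathcal{L},\theta,\mathcal{I}_\alpha)$ generated by the standard generators $s_{\alpha,A}s_{\beta,A}^*$ ($\alpha,\beta\in\mathcal{L}^*$, $A\in\mathcal{I}_\alpha\cap\mathcal{I}_\beta$) that satisfy one of the following: (1) $\alpha=\beta$; (2) $\alpha=\beta\gamma$ and $(\gamma,A)$ is a cycle with no exits; (3) $\beta=\alpha\gamma$ and $(\gamma,A)$ is a cycle with no exits. Then $M$ is commutative and satisfies $D\subseteq M\subseteq D'$, where $D$ is the diagonal subalgebra and $D'$ is its commutant in $C^*(\mathcal{B},\mathcal{L},\theta,\mathcal{I}_\alpha)$.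
   Context: Boolean dynamical systems. A Boolean algebra is a relatively complemented distributive lattice $\mathcal{B}$ with least element $\emptyset$ (no greatest element is required), with meet $\cap$, join $\cup$, relative complement $\setminus$ and order $A\subseteq B \iff A\cap B=A$. An ideal of $\mathcal{B}$ is a non-empty subset closed under finite unions and downward closed. An action on $\mathcal{B}$ is a map $\mathcal{B}\to\mathcal{B}$ preserving $\cap,\cup,\setminus$ and sending $\emptyset$ to $\emptyset$. For a set $\mathcal{L}$, $\mathcal{L}^{\geq 1}$ is the set of non-empty finite words over $\mathcal{L}$ and $\mathcal{L}^*=\mathcal{L}^{\ge1}\cup\{\emptyset\}$, where $\emptyset$ also denotes the empty word; $|\alpha|$ is the length of $\alpha$, and $\alpha_{i,j}=\alpha_i\cdots\alpha_j$. A Boolean dynamical system is a triple $(\mathcal{B},\mathcal{L},\theta)$ with $\mathcal{B}$ a Boolean algebra, $\mathcal{L}$ a set and $\{\theta_\alpha\}_{\alpha\in\mathcal{L}}$ a family of actions on $\mathcal{B}$; for $\alpha=\alpha_1\cdots\alpha_n$ put $\theta_\alpha=\theta_{\alpha_n}\circ\cdots\circ\theta_{\alpha_1}$, and $\theta_\emptyset=\mathrm{Id}$. For $B\in\mathcal{B}$, $\Delta_B=\{\alpha\in\mathcal{L}:\theta_\alpha(B)\ne\emptyset\}$. $A\in\mathcal{B}$ is regular if $0<|\Delta_B|<\infty$ for every $\emptyset\neq B\subseteq A$; $\mathcal{B}_{reg}$ is the set of regular elements (including $\emptyset$). Cycles. For $\alpha=\alpha_1\cdots\alpha_n\in\mathcal{L}^{\ge1}$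 and $\emptyset\ne A\in\mathcal{B}$, the pair $(\alpha,A)$ is a cycle if $\theta_\alpha(B)=B$ for all $B\subseteq A$. A cycle $(\alpha,A)$ has no exits if for every $t\in\{1,\dots,n\}$ and every $\emptyset\ne B\subseteq\theta_{\alpha_{1,t}}(A)$ we have $B\in\mathcal{B}_{reg}$ and $\Delta_B=\{\alpha_{t+1}\}$ (where $\alpha_{n+1}:=\alpha_1$). $C^*$-algebra. A generalized Boolean dynamical system $(\mathcal{B},\mathcal{L},\theta,\mathcal{I}_\alpha)$ is a Boolean dynamical system together with ideals $\mathcal{I}_\alpha\subseteq\mathcal{B}$ ($\alpha\in\mathcal{L}$) such that $\theta_\alpha(\mathcal{B})\subseteq\mathcal{I}_\alpha$. A representation of it in a $C^*$-algebra consists of projections $\{P_A:A\in\mathcal{B}\}$ and partial isometries $\{S_{\alpha,B}:\alpha\in\mathcal{L},B\in\mathcal{I}_\alpha\}$ such that: (i) $P_\emptyset=0$, $P_{A\cap A'}=P_AP_{A'}$, $P_{A\cup A'}=P_A+P_{A'}-P_{A\cap A'}$; (ii) $P_AS_{\alpha,B}=S_{\alpha,B}P_{\theta_\alpha(A)}$; (iii) $S_{\alpha,B}^*S_{\alpha',B'}=\delta_{\alpha,\alpha'}P_{B\cap B'}$; (iv) $P_A=\sum_{\alpha\in\Delta_A}S_{\alpha,\theta_\alpha(A)}S_{\alpha,\theta_\alpha(A)}^*$ for $A\in\mathcal{B}_{reg}$. $C^*(\mathcal{B},\mathcal{L},\theta,\mathcal{I}_\alpha)$ is the $C^*$-algebra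 generated by a universal representation $\{p_A,s_{\alpha,B}\}$. Put $\mathcal{I}_\emptyset=\mathcal{B}$ and, for $\alpha=\alpha_1\cdots\alpha_n$, $\mathcal{I}_\alpha=\{A\in\mathcal{B}: A\subseteq\theta_{\alpha_2\cdots\alpha_n}(B)\text{ for some }B\in\mathcal{I}_{\alpha_1}\}$. Put $s_{\emptyset,A}=p_A$ and, for $\alpha=\alpha_1\cdots\alpha_n$ and $A\in\mathcal{I}_\alpha$, $s_{\alpha,A}=s_{\alpha_1,B}s_{\alpha_2,\theta_{\alpha_2}(B)}s_{\alpha_3,\theta_{\alpha_2\alpha_3}(B)}\cdots s_{\alpha_n,A}$, where $B\in\mathcal{I}_{\alpha_1}$ satisfies $A\subseteq\theta_{\alpha_2\cdots\alpha_n}(B)$. The diagonal subalgebra $D$ is the $C^*$-subalgebra generated by the commuting projections $s_{\alpha,A}s_{\alpha,A}^*$, $\alpha\in\mathcal{L}^*$, $A\in\mathcal{I}_\alpha$. Its commutant $D'$ is the set of $x\in C^*(\mathcal{B},\mathcal{L},\theta,\mathcal{I}_\alpha)$ commuting with all $s_{\alpha,A}s_{\alpha,A}^*$, $\alpha\in\mathcal{L}^*$, $A\in\mathcal{I}_\alpha$. *)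

theory Defs
  imports "HOL-Algebra.Module" "HOL-Analysis.Abstract_Metric_Spaces"
begin

section \<open>Boolean dynamical systems\<close>

text \<open>A Boolean algebra without a greatest element: a distributive lattice with least element
  in which \<open>x - y\<close> is the complement of \<open>inf x y\<close> in the interval from \<open>bot\<close> to \<open>x\<close>.\<close>

class generalized_boolean_algebra = distrib_lattice + bounded_lattice_bot + minus +
  assumes inf_minus_eq_bot: "inf (inf x y) (x - y) = bot"
    and sup_minus_eq: "sup (inf x y) (x - y) = x"

text \<open>This is relative complementedness: every interval is complemented.\<close>

lemma (in generalized_boolean_algebra) relative_complement:
  assumes "a \<le> x" "x \<le> b"
  shows "inf x (sup a (b - x)) = a" "sup x (sup a (b - x)) = b"
proof -
  have bx: "inf b x = x" using assms by (simp add: inf_absorb2)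
  have 1: "inf x (b - x) = bot" using inf_minus_eq_bot[of b x] bx by simp
  have 2: "sup x (b - x) = b" using sup_minus_eq[of b x] bx by simp
  show "inf x (sup a (b - x)) = a"
    using 1 assms by (simp add: inf_sup_distrib1 inf_absorb2)
  show "sup x (sup a (b - x)) = b"
    using 2 assms by (metis sup.absorb1 sup.assoc)
qed

definition boolean_ideal :: "'b::generalized_boolean_algebra set \<Rightarrow> bool" where
  "boolean_ideal J \<longleftrightarrow>
     J \<noteq> {} \<and> (\<forall>x\<in>J. \<forall>y\<in>J. sup x y \<in> J) \<and> (\<forall>x\<in>J. \<forall>y. y \<le> x \<longrightarrow> y \<in> J)"

definition boolean_action :: "('b::generalized_boolean_algebra \<Rightarrow> 'b) \<Rightarrow> bool" where
  "boolean_action f \<longleftrightarrow> f bot = bot \<and>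
     (\<forall>x y. f (inf x y) = inf (f x) (f y) \<and> f (sup x y) = sup (f x) (f y) \<and> f (x - y) = f x - f y)"

locale boolean_dynamical_system =
  fixes L :: "'l set" and \<theta> :: "'l \<Rightarrow> 'b::generalized_boolean_algebra \<Rightarrow> 'b"
  assumes action: "\<alpha> \<in> L \<Longrightarrow> boolean_action (\<theta> \<alpha>)"

locale generalized_boolean_dynamical_system = boolean_dynamical_system L \<theta>
  for L :: "'l set" and \<theta> :: "'l \<Rightarrow> 'b::generalized_boolean_algebra \<Rightarrow> 'b" +
  fixes I :: "'l \<Rightarrow> 'b set"
  assumes ideal: "\<alpha> \<in> L \<Longrightarrow> boolean_ideal (I \<alpha>)"
    and range_subset: "\<alpha> \<in> L \<Longrightarrow> range (\<theta> \<alpha>) \<subseteq> I \<alpha>"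

text \<open>Words over \<open>L\<close> are the elements of \<open>lists L\<close>; the first letter of the word acts first.\<close>

definition word_action :: "('l \<Rightarrow> 'b \<Rightarrow> 'b) \<Rightarrow> 'l list \<Rightarrow> 'b \<Rightarrow> 'b" where
  "word_action \<theta> w = fold \<theta> w"

definition out_labels :: "'l set \<Rightarrow> ('l \<Rightarrow> 'b::generalized_boolean_algebra \<Rightarrow> 'b) \<Rightarrow> 'b \<Rightarrow> 'l set" where
  "out_labels L \<theta> B = {\<alpha> \<in> L. \<theta> \<alpha> B \<noteq> bot}"

definition regular :: "'l set \<Rightarrow> ('l \<Rightarrow> 'b::generalized_boolean_algebra \<Rightarrow> 'b) \<Rightarrow> 'b \<Rightarrow> bool" where
  "regular L \<theta> B \<longleftrightarrow>
     (\<forall>C. C \<noteq> bot \<and> C \<le> B \<longrightarrow> finite (out_labels L \<theta> C) \<and> out_labels L \<theta> C \<noteq> {})"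

definition cycle :: "'l set \<Rightarrow> ('l \<Rightarrow> 'b::generalized_boolean_algebra \<Rightarrow> 'b) \<Rightarrow> 'l list \<Rightarrow> 'b \<Rightarrow> bool" where
  "cycle L \<theta> w B \<longleftrightarrow>
     w \<in> lists L \<and> w \<noteq> [] \<and> B \<noteq> bot \<and> (\<forall>C. C \<le> B \<longrightarrow> word_action \<theta> w C = C)"

text \<open>Lists are indexed from \<open>0\<close>, so \<open>w ! (t mod length w)\<close> is the letter \<open>w\<^sub>t\<^sub>+\<^sub>1\<close>, read cyclically.\<close>

definition no_exits :: "'l set \<Rightarrow> ('l \<Rightarrow> 'b::generalized_boolean_algebra \<Rightarrow> 'b) \<Rightarrow> 'l list \<Rightarrow> 'b \<Rightarrow> bool" where
  "no_exits L \<theta> w B \<longleftrightarrow>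
     (\<forall>t\<in>{1..length w}. \<forall>C. C \<noteq> bot \<and> C \<le> word_action \<theta> (take t w) B \<longrightarrow>
        regular L \<theta> C \<and> out_labels L \<theta> C = {w ! (t mod length w)})"

fun word_ideal :: "('l \<Rightarrow> 'b::generalized_boolean_algebra \<Rightarrow> 'b) \<Rightarrow> ('l \<Rightarrow> 'b set) \<Rightarrow> 'l list \<Rightarrow> 'b set" where
  "word_ideal \<theta> I [] = UNIV"
| "word_ideal \<theta> I (a # w) = {A. \<exists>B\<in>I a. A \<le> word_action \<theta> w B}"


section \<open>C*-algebras\<close>

text \<open>The inherited field \<^const>\<open>one\<close> carries no meaning here: C*-algebras need not be unital.\<close>

record 'a cstar = "(complex, 'a) module" +
  star :: "'a \<Rightarrow> 'a"
  cnorm :: "'a \<Rightarrow> real"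

text \<open>The value \<open>0\<close> outside the carrier is only there because \<^locale>\<open>Metric_space\<close> wants a
  nonnegative symmetric function on the whole type.\<close>

definition cdist :: "'a cstar \<Rightarrow> 'a \<Rightarrow> 'a \<Rightarrow> real" where
  "cdist A x y = (if x \<in> carrier A \<and> y \<in> carrier A then cnorm A (x \<ominus>\<^bsub>A\<^esub> y) else 0)"

abbreviation norm_topology :: "'a cstar \<Rightarrow> 'a topology" where
  "norm_topology A \<equiv> Metric_space.mtopology (carrier A) (cdist A)"

locale cstar_algebra = abelian_group A for A :: "'a cstar" (structure) +
  assumes m_closed: "\<lbrakk>x \<in> carrier A; y \<in> carrier A\<rbrakk> \<Longrightarrow> x \<otimes> y \<in> carrier A"
    and smult_closed: "x \<in> carrier A \<Longrightarrow> c \<odot> x \<in> carrier A"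
    and star_closed: "x \<in> carrier A \<Longrightarrow> star A x \<in> carrier A"
    and smult_l_distr: "x \<in> carrier A \<Longrightarrow> (c + d) \<odot> x = c \<odot> x \<oplus> d \<odot> x"
    and smult_r_distr: "\<lbrakk>x \<in> carrier A; y \<in> carrier A\<rbrakk> \<Longrightarrow> c \<odot> (x \<oplus> y) = c \<odot> x \<oplus> c \<odot> y"
    and smult_assoc: "x \<in> carrier A \<Longrightarrow> (c * d) \<odot> x = c \<odot> (d \<odot> x)"
    and smult_one: "x \<in> carrier A \<Longrightarrow> 1 \<odot> x = x"
    and m_assoc: "\<lbrakk>x \<in> carrier A; y \<in> carrier A; z \<in> carrier A\<rbrakk> \<Longrightarrow> (x \<otimes> y) \<otimes> z = x \<otimes> (y \<otimes> z)"
    and l_distr: "\<lbrakk>x \<in> carrier A; y \<in> carrier A; z \<in> carrier A\<rbrakk> \<Longrightarrow> (x \<oplus> y) \<otimes> z = x \<otimes> z \<oplus> y \<otimes> z"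
    and r_distr: "\<lbrakk>x \<in> carrier A; y \<in> carrier A; z \<in> carrier A\<rbrakk> \<Longrightarrow> z \<otimes> (x \<oplus> y) = z \<otimes> x \<oplus> z \<otimes> y"
    and smult_m_left: "\<lbrakk>x \<in> carrier A; y \<in> carrier A\<rbrakk> \<Longrightarrow> (c \<odot> x) \<otimes> y = c \<odot> (x \<otimes> y)"
    and smult_m_right: "\<lbrakk>x \<in> carrier A; y \<in> carrier A\<rbrakk> \<Longrightarrow> x \<otimes> (c \<odot> y) = c \<odot> (x \<otimes> y)"
    and star_star: "x \<in> carrier A \<Longrightarrow> star A (star A x) = x"
    and star_add: "\<lbrakk>x \<in> carrier A; y \<in> carrier A\<rbrakk> \<Longrightarrow> star A (x \<oplus> y) = star A x \<oplus> star A y"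
    and star_smult: "x \<in> carrier A \<Longrightarrow> star A (c \<odot> x) = cnj c \<odot> star A x"
    and star_mult: "\<lbrakk>x \<in> carrier A; y \<in> carrier A\<rbrakk> \<Longrightarrow> star A (x \<otimes> y) = star A y \<otimes> star A x"
    and cnorm_nonneg: "x \<in> carrier A \<Longrightarrow> 0 \<le> cnorm A x"
    and cnorm_eq_0: "x \<in> carrier A \<Longrightarrow> cnorm A x = 0 \<longleftrightarrow> x = \<zero>"
    and cnorm_smult: "x \<in> carrier A \<Longrightarrow> cnorm A (c \<odot> x) = cmod c * cnorm A x"
    and cnorm_triangle: "\<lbrakk>x \<in> carrier A; y \<in> carrier A\<rbrakk> \<Longrightarrow> cnorm A (x \<oplus> y) \<le> cnorm A x + cnorm A y"
    and cnorm_mult: "\<lbrakk>x \<in> carrier A; y \<in> carrier A\<rbrakk> \<Longrightarrow> cnorm A (x \<otimes> y) \<le> cnorm A x * cnorm A y"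
    and cstar_identity: "x \<in> carrier A \<Longrightarrow> cnorm A (star A x \<otimes> x) = (cnorm A x)\<^sup>2"
    and complete: "Metric_space.mcomplete (carrier A) (cdist A)"

definition cstar_subalgebra :: "'a cstar \<Rightarrow> 'a set \<Rightarrow> bool" where
  "cstar_subalgebra A M \<longleftrightarrow>
     M \<subseteq> carrier A \<and> \<zero>\<^bsub>A\<^esub> \<in> M \<and>
     (\<forall>x\<in>M. \<forall>y\<in>M. x \<oplus>\<^bsub>A\<^esub> y \<in> M \<and> x \<otimes>\<^bsub>A\<^esub> y \<in> M) \<and>
     (\<forall>x\<in>M. star A x \<in> M \<and> (\<forall>c. c \<odot>\<^bsub>A\<^esub> x \<in> M)) \<and>
     closedin (norm_topology A) M"

definition cstar_generated :: "'a cstar \<Rightarrow> 'a set \<Rightarrow> 'a set" where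
  "cstar_generated A X = \<Inter>{M. cstar_subalgebra A M \<and> X \<subseteq> M}"

definition star_hom :: "'a cstar \<Rightarrow> 'c cstar \<Rightarrow> ('a \<Rightarrow> 'c) \<Rightarrow> bool" where
  "star_hom A C \<phi> \<longleftrightarrow>
     \<phi> \<in> carrier A \<rightarrow> carrier C \<and>
     (\<forall>x\<in>carrier A. \<forall>y\<in>carrier A.
        \<phi> (x \<oplus>\<^bsub>A\<^esub> y) = \<phi> x \<oplus>\<^bsub>C\<^esub> \<phi> y \<and> \<phi> (x \<otimes>\<^bsub>A\<^esub> y) = \<phi> x \<otimes>\<^bsub>C\<^esub> \<phi> y) \<and>
     (\<forall>x\<in>carrier A. \<phi> (star A x) = star C (\<phi> x) \<and> (\<forall>c. \<phi> (c \<odot>\<^bsub>A\<^esub> x) = c \<odot>\<^bsub>C\<^esub> \<phi> x))"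

definition projection :: "'a cstar \<Rightarrow> 'a \<Rightarrow> bool" where
  "projection A x \<longleftrightarrow> x \<in> carrier A \<and> x \<otimes>\<^bsub>A\<^esub> x = x \<and> star A x = x"

definition partial_isometry :: "'a cstar \<Rightarrow> 'a \<Rightarrow> bool" where
  "partial_isometry A x \<longleftrightarrow> x \<in> carrier A \<and> x \<otimes>\<^bsub>A\<^esub> star A x \<otimes>\<^bsub>A\<^esub> x = x"


section \<open>Representations and the universal C*-algebra\<close>

definition representation ::
  "'l set \<Rightarrow> ('l \<Rightarrow> 'b::generalized_boolean_algebra \<Rightarrow> 'b) \<Rightarrow> ('l \<Rightarrow> 'b set) \<Rightarrow>
   'a cstar \<Rightarrow> ('b \<Rightarrow> 'a) \<Rightarrow> ('l \<Rightarrow> 'b \<Rightarrow> 'a) \<Rightarrow> bool" where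
  "representation L \<theta> I C P S \<longleftrightarrow>
     (\<forall>A. projection C (P A)) \<and>
     (\<forall>\<alpha>\<in>L. \<forall>B\<in>I \<alpha>. partial_isometry C (S \<alpha> B)) \<and>
     P bot = \<zero>\<^bsub>C\<^esub> \<and>
     (\<forall>A A'. P (inf A A') = P A \<otimes>\<^bsub>C\<^esub> P A' \<and>
             P (sup A A') = P A \<oplus>\<^bsub>C\<^esub> P A' \<ominus>\<^bsub>C\<^esub> P (inf A A')) \<and>
     (\<forall>A. \<forall>\<alpha>\<in>L. \<forall>B\<in>I \<alpha>. P A \<otimes>\<^bsub>C\<^esub> S \<alpha> B = S \<alpha> B \<otimes>\<^bsub>C\<^esub> P (\<theta> \<alpha> A)) \<and>
     (\<forall>\<alpha>\<in>L. \<forall>B\<in>I \<alpha>. \<forall>\<alpha>'\<in>L. \<forall>B'\<in>I \<alpha>'.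
        star C (S \<alpha> B) \<otimes>\<^bsub>C\<^esub> S \<alpha>' B' = (if \<alpha> = \<alpha>' then P (inf B B') else \<zero>\<^bsub>C\<^esub>)) \<and>
     (\<forall>A. regular L \<theta> A \<longrightarrow>
        P A = (\<Oplus>\<^bsub>C\<^esub>\<alpha>\<in>out_labels L \<theta> A. S \<alpha> (\<theta> \<alpha> A) \<otimes>\<^bsub>C\<^esub> star C (S \<alpha> (\<theta> \<alpha> A))))"

definition generators ::
  "'l set \<Rightarrow> ('l \<Rightarrow> 'b set) \<Rightarrow> ('b \<Rightarrow> 'a) \<Rightarrow> ('l \<Rightarrow> 'b \<Rightarrow> 'a) \<Rightarrow> 'a set" where
  "generators L I P S = range P \<union> {S \<alpha> B | \<alpha> B. \<alpha> \<in> L \<and> B \<in> I \<alpha>}"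

datatype 'g star_expr =
  Gen 'g | Zero | Add "'g star_expr" "'g star_expr" | Mult "'g star_expr" "'g star_expr"
  | Smult complex "'g star_expr" | Star "'g star_expr"

text \<open>A formula cannot quantify over all C*-algebras of all types. It is enough to test
  universality on C*-algebras whose carrier lies in the type of sequences of *-polynomial
  expressions in the generators: every element of a C*-algebra generated by a representation is
  the limit of such a sequence, so the algebra has an isomorphic copy with carrier in that type.
  Lemma \<open>universal_representation_lift\<close> below derives the universal property for
  representations in C*-algebras of arbitrary type.\<close>

type_synonym ('l, 'b) test_elem = "nat \<Rightarrow> ('b + 'l \<times> 'b) star_expr"

definition universal_representation ::
  "'l set \<Rightarrow> ('l \<Rightarrow> 'b::generalized_boolean_algebra \<Rightarrow> 'b) \<Rightarrow> ('l \<Rightarrow> 'b set) \<Rightarrow>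
   'a cstar \<Rightarrow> ('b \<Rightarrow> 'a) \<Rightarrow> ('l \<Rightarrow> 'b \<Rightarrow> 'a) \<Rightarrow> bool" where
  "universal_representation L \<theta> I A p s \<longleftrightarrow>
     cstar_algebra A \<and> representation L \<theta> I A p s \<and>
     cstar_generated A (generators L I p s) = carrier A \<and>
     (\<forall>(C :: ('l, 'b) test_elem cstar) P S.
        cstar_algebra C \<and> representation L \<theta> I C P S \<longrightarrow>
        (\<exists>\<phi>. star_hom A C \<phi> \<and> (\<forall>B. \<phi> (p B) = P B) \<and>
             (\<forall>\<alpha>\<in>L. \<forall>B\<in>I \<alpha>. \<phi> (s \<alpha> B) = S \<alpha> B)))"


section \<open>The elements \<open>s\<^sub>\<alpha>\<^sub>,\<^sub>A\<close> and the subalgebras they generate\<close>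

text \<open>\<open>path_product\<close> of \<open>B\<close>, \<open>\<alpha>\<^sub>1\<dots>\<alpha>\<^sub>n\<close> and \<open>A\<close> is the product of \<open>s\<close> at \<open>(\<alpha>\<^sub>1, B)\<close>, then
  \<open>(\<alpha>\<^sub>2, \<theta>\<^sub>\<alpha>\<^sub>2 B)\<close>, \<open>(\<alpha>\<^sub>3, \<theta>\<^sub>\<alpha>\<^sub>2\<^sub>\<alpha>\<^sub>3 B)\<close> and so on, where the last factor is \<open>s\<close> at \<open>(\<alpha>\<^sub>n, A)\<close>. In
  particular it is \<open>s \<alpha>\<^sub>1 A\<close> if \<open>n = 1\<close>. The value on the empty word is irrelevant.\<close>

fun path_product ::
  "('l \<Rightarrow> 'b \<Rightarrow> 'b) \<Rightarrow> 'a cstar \<Rightarrow> ('l \<Rightarrow> 'b \<Rightarrow> 'a) \<Rightarrow> 'b \<Rightarrow> 'l list \<Rightarrow> 'b \<Rightarrow> 'a" where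
  "path_product \<theta> C s B [] A = \<zero>\<^bsub>C\<^esub>"
| "path_product \<theta> C s B [a] A = s a A"
| "path_product \<theta> C s B (a # b # w) A = s a B \<otimes>\<^bsub>C\<^esub> path_product \<theta> C s (\<theta> b B) (b # w) A"

text \<open>The element \<open>s\<^sub>\<alpha>\<^sub>,\<^sub>A\<close>; it does not depend on the chosen \<open>B\<close>.\<close>

definition word_isometry ::
  "('l \<Rightarrow> 'b::generalized_boolean_algebra \<Rightarrow> 'b) \<Rightarrow> ('l \<Rightarrow> 'b set) \<Rightarrow>
   'a cstar \<Rightarrow> ('b \<Rightarrow> 'a) \<Rightarrow> ('l \<Rightarrow> 'b \<Rightarrow> 'a) \<Rightarrow> 'l list \<Rightarrow> 'b \<Rightarrow> 'a" where
  "word_isometry \<theta> I C p s w A =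
     (if w = [] then p A
      else path_product \<theta> C s (SOME B. B \<in> I (hd w) \<and> A \<le> word_action \<theta> (tl w) B) w A)"

definition standard_generator ::
  "('l \<Rightarrow> 'b::generalized_boolean_algebra \<Rightarrow> 'b) \<Rightarrow> ('l \<Rightarrow> 'b set) \<Rightarrow>
   'a cstar \<Rightarrow> ('b \<Rightarrow> 'a) \<Rightarrow> ('l \<Rightarrow> 'b \<Rightarrow> 'a) \<Rightarrow> 'l list \<Rightarrow> 'l list \<Rightarrow> 'b \<Rightarrow> 'a" where
  "standard_generator \<theta> I C p s \<alpha> \<beta> A =
     word_isometry \<theta> I C p s \<alpha> A \<otimes>\<^bsub>C\<^esub> star C (word_isometry \<theta> I C p s \<beta> A)"

definition diagonal_projections ::
  "'l set \<Rightarrow> ('l \<Rightarrow> 'b::generalized_boolean_algebra \<Rightarrow> 'b) \<Rightarrow> ('l \<Rightarrow> 'b set) \<Rightarrow>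
   'a cstar \<Rightarrow> ('b \<Rightarrow> 'a) \<Rightarrow> ('l \<Rightarrow> 'b \<Rightarrow> 'a) \<Rightarrow> 'a set" where
  "diagonal_projections L \<theta> I C p s =
     {standard_generator \<theta> I C p s \<alpha> \<alpha> A | \<alpha> A. \<alpha> \<in> lists L \<and> A \<in> word_ideal \<theta> I \<alpha>}"

definition diagonal_subalgebra ::
  "'l set \<Rightarrow> ('l \<Rightarrow> 'b::generalized_boolean_algebra \<Rightarrow> 'b) \<Rightarrow> ('l \<Rightarrow> 'b set) \<Rightarrow>
   'a cstar \<Rightarrow> ('b \<Rightarrow> 'a) \<Rightarrow> ('l \<Rightarrow> 'b \<Rightarrow> 'a) \<Rightarrow> 'a set" where
  "diagonal_subalgebra L \<theta> I C p s = cstar_generated C (diagonal_projections L \<theta> I C p s)"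

definition diagonal_commutant ::
  "'l set \<Rightarrow> ('l \<Rightarrow> 'b::generalized_boolean_algebra \<Rightarrow> 'b) \<Rightarrow> ('l \<Rightarrow> 'b set) \<Rightarrow>
   'a cstar \<Rightarrow> ('b \<Rightarrow> 'a) \<Rightarrow> ('l \<Rightarrow> 'b \<Rightarrow> 'a) \<Rightarrow> 'a set" where
  "diagonal_commutant L \<theta> I C p s =
     {x \<in> carrier C. \<forall>e\<in>diagonal_projections L \<theta> I C p s. x \<otimes>\<^bsub>C\<^esub> e = e \<otimes>\<^bsub>C\<^esub> x}"

definition cycle_subalgebra ::
  "'l set \<Rightarrow> ('l \<Rightarrow> 'b::generalized_boolean_algebra \<Rightarrow> 'b) \<Rightarrow> ('l \<Rightarrow> 'b set) \<Rightarrow>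
   'a cstar \<Rightarrow> ('b \<Rightarrow> 'a) \<Rightarrow> ('l \<Rightarrow> 'b \<Rightarrow> 'a) \<Rightarrow> 'a set" where
  "cycle_subalgebra L \<theta> I C p s = cstar_generated C
     {standard_generator \<theta> I C p s \<alpha> \<beta> A | \<alpha> \<beta> A.
        \<alpha> \<in> lists L \<and> \<beta> \<in> lists L \<and> A \<in> word_ideal \<theta> I \<alpha> \<inter> word_ideal \<theta> I \<beta> \<and>
        (\<alpha> = \<beta> \<or>
         (\<exists>\<gamma>. \<alpha> = \<beta> @ \<gamma> \<and> cycle L \<theta> \<gamma> A \<and> no_exits L \<theta> \<gamma> A) \<or>
         (\<exists>\<gamma>. \<beta> = \<alpha> @ \<gamma> \<and> cycle L \<theta> \<gamma> A \<and> no_exits L \<theta> \<gamma> A))}"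

section \<open>The universal property in arbitrary types\<close>

context cstar_algebra
begin

lemma smult_zero: "x \<in> carrier A \<Longrightarrow> 0 \<odot> x = \<zero>"
  using smult_l_distr[of x 0 0] smult_closed[of x 0] by (simp add: r_neg1 add.l_cancel_one')

lemma a_inv_smult: "x \<in> carrier A \<Longrightarrow> \<ominus> x = (-1) \<odot> x"
  using smult_l_distr[of x "-1" 1] smult_closed[of x "-1"] smult_one[of x] smult_zero[of x]
  by (simp add: minus_equality)

lemma minus_smult: "\<lbrakk>x \<in> carrier A; y \<in> carrier A\<rbrakk> \<Longrightarrow> x \<ominus> y = x \<oplus> (-1) \<odot> y"
  by (simp add: a_minus_def a_inv_smult)

lemma cnorm_minus: "x \<in> carrier A \<Longrightarrow> cnorm A (\<ominus> x) = cnorm A x"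
  by (simp add: a_inv_smult cnorm_smult)

lemma cnorm_minus_commute:
  "\<lbrakk>x \<in> carrier A; y \<in> carrier A\<rbrakk> \<Longrightarrow> cnorm A (x \<ominus> y) = cnorm A (y \<ominus> x)"
proof -
  assume xy: "x \<in> carrier A" "y \<in> carrier A"
  then have "\<ominus> (x \<ominus> y) = y \<ominus> x" by (simp add: a_minus_def minus_add a_comm)
  then show ?thesis using cnorm_minus[of "x \<ominus> y"] xy by simp
qed

lemma cnorm_minus_triangle:
  assumes "x \<in> carrier A" "y \<in> carrier A" "z \<in> carrier A"
  shows "cnorm A (x \<ominus> z) \<le> cnorm A (x \<ominus> y) + cnorm A (y \<ominus> z)"
proof -
  have "x \<ominus> z = (x \<ominus> y) \<oplus> (y \<ominus> z)" using assms
    by (simp add: a_minus_def a_assoc r_neg1)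
  then show ?thesis using cnorm_triangle assms by simp
qed

lemma minus_eq_zero_iff: "\<lbrakk>x \<in> carrier A; y \<in> carrier A\<rbrakk> \<Longrightarrow> x \<ominus> y = \<zero> \<longleftrightarrow> x = y"
  using minus_equality[of x "\<ominus> y"] by (auto simp: a_minus_def r_neg)

lemma minus_add_cancel:
  assumes "u \<in> carrier A" "v \<in> carrier A" "w \<in> carrier A"
  shows "(u \<ominus> v) \<oplus> (w \<ominus> u) = w \<ominus> v"
proof -
  have "(u \<ominus> v) \<oplus> (w \<ominus> u) = (w \<oplus> \<ominus> v) \<oplus> (u \<oplus> \<ominus> u)"
    using assms by (simp add: a_minus_def a_ac)
  then show ?thesis using assms by (simp add: r_neg a_minus_def)
qed

lemma metric: "Metric_space (carrier A) (cdist A)"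
proof
  fix x y z
  show "0 \<le> cdist A x y" by (simp add: cdist_def cnorm_nonneg)
  show "cdist A x y = cdist A y x" by (simp add: cdist_def cnorm_minus_commute)
  assume x: "x \<in> carrier A" and y: "y \<in> carrier A"
  show "cdist A x y = 0 \<longleftrightarrow> x = y" using x y by (simp add: cdist_def cnorm_eq_0 minus_eq_zero_iff)
  assume z: "z \<in> carrier A"
  show "cdist A x z \<le> cdist A x y + cdist A y z"
    using x y z by (simp add: cdist_def cnorm_minus_triangle)
qed

lemma cnorm_star: assumes x: "x \<in> carrier A" shows "cnorm A (star A x) = cnorm A x"
proof -
  have le: "cnorm A y \<le> cnorm A (star A y)" if y: "y \<in> carrier A" for y
  proof (cases "cnorm A y = 0")
    case False
    have "cnorm A y * cnorm A y \<le> cnorm A (star A y) * cnorm A y"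
      using cnorm_mult[of "star A y" y] y star_closed cstar_identity[of y]
      by (simp add: power2_eq_square)
    then show ?thesis using False cnorm_nonneg[OF y] by simp
  qed (simp add: cnorm_nonneg star_closed y)
  show ?thesis using le[OF x] le[OF star_closed[OF x]] star_star[OF x] by simp
qed

lemma closure_iff:
  assumes "X \<subseteq> carrier A"
  shows "x \<in> norm_topology A closure_of X \<longleftrightarrow>
    x \<in> carrier A \<and> (\<forall>e>0. \<exists>y\<in>X. cnorm A (x \<ominus> y) < e)"
  using assms
  by (auto simp: Metric_space.metric_closure_of[OF metric] Metric_space.in_mball[OF metric] cdist_def subset_iff)

lemma closedin_iff:
  "closedin (norm_topology A) X \<longleftrightarrow> X \<subseteq> carrier A \<and>
     (\<forall>x\<in>carrier A. (\<forall>e>0. \<exists>y\<in>X. cnorm A (x \<ominus> y) < e) \<longrightarrow> x \<in> X)"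
proof (cases "X \<subseteq> carrier A")
  case True
  have "closedin (norm_topology A) X \<longleftrightarrow> norm_topology A closure_of X \<subseteq> X"
    using True Metric_space.topspace_mtopology[OF metric] closure_of_subset_eq
    by (metis)
  then show ?thesis using True closure_iff[OF True] by blast
next
  case False
  then show ?thesis
    using closedin_subset Metric_space.topspace_mtopology[OF metric] by metis
qed

end

lemma (in cstar_algebra) closure_subalgebra:
  assumes K: "K \<subseteq> carrier A" "\<zero> \<in> K"
    and add: "\<And>x y. \<lbrakk>x \<in> K; y \<in> K\<rbrakk> \<Longrightarrow> x \<oplus> y \<in> K"
    and mult: "\<And>x y. \<lbrakk>x \<in> K; y \<in> K\<rbrakk> \<Longrightarrow> x \<otimes> y \<in> K"
    and sm: "\<And>x c. x \<in> K \<Longrightarrow> c \<odot> x \<in> K"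
    and st: "\<And>x. x \<in> K \<Longrightarrow> star A x \<in> K"
  shows "cstar_subalgebra A (norm_topology A closure_of K)" (is "cstar_subalgebra A ?M")
proof -
  have KM: "K \<subseteq> ?M" using K(1) Metric_space.topspace_mtopology[OF metric]
    by (metis closure_of_subset)
  have MA: "x \<in> carrier A" if "x \<in> ?M" for x using that closure_iff[OF K(1)] by blast
  have KA: "x \<in> carrier A" if "x \<in> K" for x using that K by blast
  have ap: "\<exists>y\<in>K. cnorm A (x \<ominus> y) < e" if "x \<in> ?M" "e > 0" for x e
    using that closure_iff[OF K(1)] by blast
  have M: "x \<in> ?M" if "x \<in> carrier A" "\<And>e. e > 0 \<Longrightarrow> \<exists>y\<in>K. cnorm A (x \<ominus> y) < e" for x
    using that closure_iff[OF K(1)] by blast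
  note cl = m_closed smult_closed star_closed minus_smult
  have "x \<oplus> y \<in> ?M" if x: "x \<in> ?M" and y: "y \<in> ?M" for x y
  proof (rule M)
    show "x \<oplus> y \<in> carrier A" using MA x y by simp
    fix e :: real assume "e > 0"
    then obtain x' y' where k: "x' \<in> K" "y' \<in> K" and
      d: "cnorm A (x \<ominus> x') < e/2" "cnorm A (y \<ominus> y') < e/2"
      using ap[OF x] ap[OF y] by (meson half_gt_zero)
    have "(x \<oplus> y) \<ominus> (x' \<oplus> y') = (x \<ominus> x') \<oplus> (y \<ominus> y')"
      using MA[OF x] MA[OF y] KA k by (simp add: cl smult_r_distr a_ac)
    then have "cnorm A ((x \<oplus> y) \<ominus> (x' \<oplus> y')) < e"
      using cnorm_triangle[of "x \<ominus> x'" "y \<ominus> y'"] MA[OF x] MA[OF y] KA k d by simp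
    then show "\<exists>z\<in>K. cnorm A ((x \<oplus> y) \<ominus> z) < e" using add k by blast
  qed
  moreover have "x \<otimes> y \<in> ?M" if x: "x \<in> ?M" and y: "y \<in> ?M" for x y
  proof (rule M)
    show "x \<otimes> y \<in> carrier A" using MA x y by (simp add: m_closed)
    fix e :: real assume e: "e > 0"
    define c where "c = cnorm A x + cnorm A y + 1"
    have c: "c \<ge> 1" using cnorm_nonneg MA x y by (simp add: c_def)
    define d where "d = min 1 (e / (2 * c))"
    have d: "d > 0" "d \<le> 1" "d * c < e" using e c
      by (auto simp: d_def min_def field_simps)
    obtain x' y' where k: "x' \<in> K" "y' \<in> K" and
      dd: "cnorm A (x \<ominus> x') < d" "cnorm A (y \<ominus> y') < d"
      using ap[OF x d(1)] ap[OF y d(1)] by blast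
    note ca = MA[OF x] MA[OF y] KA[OF k(1)] KA[OF k(2)]
    have "cnorm A y' \<le> cnorm A y + cnorm A (y' \<ominus> y)"
      using cnorm_triangle[of y "y' \<ominus> y"] ca by (simp add: a_minus_def a_ac r_neg1 r_neg2 r_neg)
    then have y': "cnorm A y' \<le> cnorm A y + d" using dd ca cnorm_minus_commute[of y y'] by simp
    have "(x \<otimes> y) \<ominus> (x' \<otimes> y') = ((x \<ominus> x') \<otimes> y') \<oplus> (x \<otimes> (y \<ominus> y'))"
    proof -
      have "((x \<ominus> x') \<otimes> y') \<oplus> (x \<otimes> (y \<ominus> y'))
         = (x \<otimes> y' \<oplus> (-1) \<odot> (x' \<otimes> y')) \<oplus> (x \<otimes> y \<oplus> (-1) \<odot> (x \<otimes> y'))"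
        using ca by (simp add: cl l_distr r_distr smult_m_left smult_m_right)
      also have "\<dots> = (x \<otimes> y' \<ominus> x' \<otimes> y') \<oplus> (x \<otimes> y \<ominus> x \<otimes> y')"
        using ca by (simp add: cl)
      also have "\<dots> = x \<otimes> y \<ominus> x' \<otimes> y'"
        using ca by (intro minus_add_cancel m_closed)
      finally show ?thesis by simp
    qed
    then have "cnorm A ((x \<otimes> y) \<ominus> (x' \<otimes> y'))
       \<le> cnorm A ((x \<ominus> x') \<otimes> y') + cnorm A (x \<otimes> (y \<ominus> y'))"
      using cnorm_triangle ca by (simp add: m_closed)
    also have "\<dots> \<le> cnorm A (x \<ominus> x') * cnorm A y' + cnorm A x * cnorm A (y \<ominus> y')"
      using cnorm_mult ca by (intro add_mono) simp_all
    also have "\<dots> \<le> d * (cnorm A y + d) + cnorm A x * d"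
      using dd y' d cnorm_nonneg ca by (intro add_mono mult_mono) simp_all
    also have "\<dots> \<le> d * c" using d unfolding c_def
      by (simp add: algebra_simps mult_left_le)
    finally have "cnorm A ((x \<otimes> y) \<ominus> (x' \<otimes> y')) < e" using d by simp
    then show "\<exists>z\<in>K. cnorm A ((x \<otimes> y) \<ominus> z) < e" using mult k by blast
  qed
  moreover have "star A x \<in> ?M" if x: "x \<in> ?M" for x
  proof (rule M)
    show "star A x \<in> carrier A" using MA x by (simp add: star_closed)
    fix e :: real assume "e > 0"
    then obtain x' where k: "x' \<in> K" and d: "cnorm A (x \<ominus> x') < e"
      using ap[OF x] by blast
    have "star A x \<ominus> star A x' = star A (x \<ominus> x')"
      using MA[OF x] KA[OF k] by (simp add: cl star_add star_smult)
    then show "\<exists>z\<in>K. cnorm A (star A x \<ominus> z) < e"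
      using d cnorm_star[of "x \<ominus> x'"] MA[OF x] KA[OF k] st[OF k]
      by (intro bexI[of _ "star A x'"]) simp_all
  qed
  moreover have "c \<odot> x \<in> ?M" if x: "x \<in> ?M" for x c
  proof (rule M)
    show "c \<odot> x \<in> carrier A" using MA x by (simp add: smult_closed)
    fix e :: real assume e: "e > 0"
    have p: "cmod c + 1 > 0" by (simp add: add_nonneg_pos)
    then obtain x' where k: "x' \<in> K" and d: "cnorm A (x \<ominus> x') < e / (cmod c + 1)"
      using ap[OF x] e by (meson divide_pos_pos)
    have "c \<odot> x \<ominus> c \<odot> x' = c \<odot> (x \<ominus> x')"
      using MA[OF x] KA[OF k] by (simp add: cl smult_r_distr flip: smult_assoc)
    then have "cnorm A (c \<odot> x \<ominus> c \<odot> x') = cmod c * cnorm A (x \<ominus> x')"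
      using MA[OF x] KA[OF k] by (simp add: cnorm_smult)
    also have "\<dots> \<le> (cmod c + 1) * cnorm A (x \<ominus> x')"
      using cnorm_nonneg MA[OF x] KA[OF k] by (intro mult_right_mono) simp_all
    also have "\<dots> < e" using d p by (simp add: field_simps)
    finally show "\<exists>z\<in>K. cnorm A (c \<odot> x \<ominus> z) < e" using sm[OF k] by blast
  qed
  ultimately show ?thesis
    using KM K(2) MA by (auto simp: cstar_subalgebra_def)
qed

lemma (in cstar_algebra) cstar_subalgebra_generated:
  assumes "X \<subseteq> carrier A"
  shows "cstar_subalgebra A (cstar_generated A X)"
proof -
  have "cstar_subalgebra A (carrier A)"
    using closedin_iff by (auto simp: cstar_subalgebra_def m_closed smult_closed star_closed)
  then have ne: "{M. cstar_subalgebra A M \<and> X \<subseteq> M} \<noteq> {}" using assms by blast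
  have "closedin (norm_topology A) (cstar_generated A X)"
    unfolding cstar_generated_def using ne
    by (rule closedin_Inter) (simp add: cstar_subalgebra_def)
  moreover have "cstar_generated A X \<subseteq> carrier A"
    unfolding cstar_generated_def using ne by (auto simp: cstar_subalgebra_def)
  ultimately show ?thesis
    unfolding cstar_subalgebra_def by (auto simp: cstar_generated_def cstar_subalgebra_def)
qed

primrec eval_expr :: "'a cstar \<Rightarrow> ('g \<Rightarrow> 'a) \<Rightarrow> 'g star_expr \<Rightarrow> 'a" where
  "eval_expr A g (Gen i) = g i"
| "eval_expr A g Zero = \<zero>\<^bsub>A\<^esub>"
| "eval_expr A g (Add e f) = eval_expr A g e \<oplus>\<^bsub>A\<^esub> eval_expr A g f"
| "eval_expr A g (Mult e f) = eval_expr A g e \<otimes>\<^bsub>A\<^esub> eval_expr A g f"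
| "eval_expr A g (Smult c e) = c \<odot>\<^bsub>A\<^esub> eval_expr A g e"
| "eval_expr A g (Star e) = star A (eval_expr A g e)"

lemma (in cstar_algebra) small_subalgebra:
  fixes g :: "'g \<Rightarrow> 'a"
  assumes "range g \<subseteq> carrier A"
  obtains M and f :: "'a \<Rightarrow> nat \<Rightarrow> 'g star_expr"
  where "cstar_subalgebra A M" "range g \<subseteq> M" "inj_on f M"
proof -
  define K where "K = range (eval_expr A g)"
  have "eval_expr A g e \<in> carrier A" for e
    using assms by (induction e) (auto simp: m_closed smult_closed star_closed)
  then have K: "K \<subseteq> carrier A" by (auto simp: K_def)
  have ev: "eval_expr A g e \<in> K" for e by (simp add: K_def)
  define M where "M = norm_topology A closure_of K"
  have "cstar_subalgebra A M" unfolding M_def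
  proof (rule closure_subalgebra[OF K])
    show "\<zero> \<in> K" using ev[of Zero] by simp
    show "x \<oplus> y \<in> K" if "x \<in> K" "y \<in> K" for x y
    proof -
      obtain e f where "x = eval_expr A g e" "y = eval_expr A g f" using \<open>x \<in> K\<close> \<open>y \<in> K\<close> by (auto simp: K_def)
      then show ?thesis using ev[of "Add e f"] by simp
    qed
    show "x \<otimes> y \<in> K" if "x \<in> K" "y \<in> K" for x y
    proof -
      obtain e f where "x = eval_expr A g e" "y = eval_expr A g f" using \<open>x \<in> K\<close> \<open>y \<in> K\<close> by (auto simp: K_def)
      then show ?thesis using ev[of "Mult e f"] by simp
    qed
    show "c \<odot> x \<in> K" if "x \<in> K" for x c
    proof -
      obtain e where "x = eval_expr A g e" using \<open>x \<in> K\<close> by (auto simp: K_def)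
      then show ?thesis using ev[of "Smult c e"] by simp
    qed
    show "star A x \<in> K" if "x \<in> K" for x
    proof -
      obtain e where "x = eval_expr A g e" using \<open>x \<in> K\<close> by (auto simp: K_def)
      then show ?thesis using ev[of "Star e"] by simp
    qed
  qed
  moreover have "range g \<subseteq> M"
  proof -
    have "range g \<subseteq> K" using ev[of "Gen i" for i] by (simp add: image_subset_iff)
    moreover have "K \<subseteq> M" unfolding M_def
      using K Metric_space.topspace_mtopology[OF metric] by (metis closure_of_subset)
    ultimately show ?thesis by blast
  qed
  moreover define f where
    "f x = (SOME \<sigma>. \<forall>n. cnorm A (x \<ominus> eval_expr A g (\<sigma> n)) < 1 / Suc n)" for x
  have f: "cnorm A (x \<ominus> eval_expr A g (f x n)) < 1 / Suc n" if "x \<in> M" for x n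
  proof -
    have "\<forall>n. \<exists>e. cnorm A (x \<ominus> eval_expr A g e) < 1 / Suc n"
    proof
      fix n
      have "\<forall>e>0. \<exists>y\<in>K. cnorm A (x \<ominus> y) < e"
        using \<open>x \<in> M\<close> closure_iff[OF K, of x] unfolding M_def by simp
      moreover have "1 / real (Suc n) > 0" by simp
      ultimately obtain y where "y \<in> K" "cnorm A (x \<ominus> y) < 1 / Suc n" by meson
      then show "\<exists>e. cnorm A (x \<ominus> eval_expr A g e) < 1 / Suc n" by (auto simp: K_def)
    qed
    then have "\<exists>\<sigma>. \<forall>n. cnorm A (x \<ominus> eval_expr A g (\<sigma> n)) < 1 / Suc n"
      by (rule choice)
    from someI_ex[OF this] show ?thesis unfolding f_def by blast
  qed
  have "inj_on f M"
  proof (rule inj_onI)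
    fix x y assume x: "x \<in> M" and y: "y \<in> M" and eq: "f x = f y"
    have c: "x \<in> carrier A" "y \<in> carrier A" using x y closure_iff[OF K] by (auto simp: M_def)
    have "cnorm A (x \<ominus> y) \<le> e" if "e > 0" for e
    proof -
      obtain n where n: "1 / Suc n < e / 2" using nat_approx_posE[of "e / 2"] \<open>e > 0\<close>
        by (meson half_gt_zero)
      let ?z = "eval_expr A g (f x n)"
      have z: "?z \<in> carrier A" using K by (auto simp: K_def)
      have "cnorm A (x \<ominus> y) \<le> cnorm A (x \<ominus> ?z) + cnorm A (?z \<ominus> y)"
        using cnorm_minus_triangle c z by blast
      then show ?thesis
        using f[OF x, of n] f[OF y, of n] n eq cnorm_minus_commute[OF z c(2)] by simp
    qed
    then have "cnorm A (x \<ominus> y) \<le> 0" by (rule field_le_epsilon[of _ 0, simplified])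
    then show "x = y" using c cnorm_nonneg[of "x \<ominus> y"] cnorm_eq_0[of "x \<ominus> y"] by (simp add: minus_eq_zero_iff)
  qed
  ultimately show thesis by (rule that)
qed

definition transport :: "'a cstar \<Rightarrow> 'a set \<Rightarrow> ('a \<Rightarrow> 'c) \<Rightarrow> 'c cstar" where
  "transport A M f =
     (let h = inv_into M f in
      \<lparr>carrier = f ` M, monoid.mult = (\<lambda>x y. f (h x \<otimes>\<^bsub>A\<^esub> h y)), one = undefined,
       zero = f \<zero>\<^bsub>A\<^esub>, add = (\<lambda>x y. f (h x \<oplus>\<^bsub>A\<^esub> h y)),
       smult = (\<lambda>c x. f (c \<odot>\<^bsub>A\<^esub> h x)), star = (\<lambda>x. f (star A (h x))),
       cnorm = (\<lambda>x. cnorm A (h x))\<rparr>)"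

context cstar_algebra
begin

context
  fixes M and f :: "'a \<Rightarrow> 'c"
  assumes M: "cstar_subalgebra A M" and inj: "inj_on f M"
begin

private abbreviation "N \<equiv> transport A M f"

lemma MA: "x \<in> M \<Longrightarrow> x \<in> carrier A"
  using M by (auto simp: cstar_subalgebra_def)

lemma M_closed:
  "\<zero> \<in> M" "\<lbrakk>x \<in> M; y \<in> M\<rbrakk> \<Longrightarrow> x \<oplus> y \<in> M" "\<lbrakk>x \<in> M; y \<in> M\<rbrakk> \<Longrightarrow> x \<otimes> y \<in> M"
  "x \<in> M \<Longrightarrow> star A x \<in> M" "x \<in> M \<Longrightarrow> c \<odot> x \<in> M"
  using M by (auto simp: cstar_subalgebra_def)

lemma M_minus: "\<lbrakk>x \<in> M; y \<in> M\<rbrakk> \<Longrightarrow> x \<ominus> y \<in> M"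
  by (simp add: minus_smult MA M_closed)

lemma N_simps:
  "carrier N = f ` M" "\<zero>\<^bsub>N\<^esub> = f \<zero>"
  "\<lbrakk>x \<in> M; y \<in> M\<rbrakk> \<Longrightarrow> f x \<oplus>\<^bsub>N\<^esub> f y = f (x \<oplus> y)"
  "\<lbrakk>x \<in> M; y \<in> M\<rbrakk> \<Longrightarrow> f x \<otimes>\<^bsub>N\<^esub> f y = f (x \<otimes> y)"
  "x \<in> M \<Longrightarrow> star N (f x) = f (star A x)"
  "x \<in> M \<Longrightarrow> c \<odot>\<^bsub>N\<^esub> f x = f (c \<odot> x)"
  "x \<in> M \<Longrightarrow> cnorm N (f x) = cnorm A x"
  using inj by (simp_all add: transport_def Let_def)

lemma N_eq: "\<lbrakk>x \<in> M; y \<in> M\<rbrakk> \<Longrightarrow> f x = f y \<longleftrightarrow> x = y"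
  using inj by (meson inj_on_eq_iff)

lemma N_group: "abelian_group N"
proof (rule abelian_groupI)
  fix x assume "x \<in> carrier N"
  then obtain a where a: "x = f a" "a \<in> M" by (auto simp: N_simps)
  have "f ((-1) \<odot> a) \<oplus>\<^bsub>N\<^esub> x = \<zero>\<^bsub>N\<^esub>"
    using a a_inv_smult[OF MA[OF a(2)]] l_neg[OF MA[OF a(2)]] by (simp add: N_simps M_closed)
  then show "\<exists>y\<in>carrier N. y \<oplus>\<^bsub>N\<^esub> x = \<zero>\<^bsub>N\<^esub>" using M_closed a by (auto simp: N_simps)
qed (auto simp: N_simps M_closed MA a_ac)

lemma N_minus: assumes "x \<in> M" "y \<in> M" shows "f x \<ominus>\<^bsub>N\<^esub> f y = f (x \<ominus> y)"
proof -
  interpret N: abelian_group N by (rule N_group)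
  have "f ((-1) \<odot> y) \<oplus>\<^bsub>N\<^esub> f y = \<zero>\<^bsub>N\<^esub>"
    using assms a_inv_smult[OF MA[OF assms(2)]] l_neg[OF MA[OF assms(2)]]
    by (simp add: N_simps M_closed)
  then have "\<ominus>\<^bsub>N\<^esub> f y = f ((-1) \<odot> y)"
    by (rule N.minus_equality) (use assms M_closed in \<open>auto simp: N_simps\<close>)
  then show ?thesis using assms by (simp add: a_minus_def[of N] minus_smult MA N_simps M_closed)
qed

lemma N_dist: "\<lbrakk>x \<in> M; y \<in> M\<rbrakk> \<Longrightarrow> cdist N (f x) (f y) = cdist A x y"
  by (simp add: cdist_def N_minus N_simps MA M_minus)

lemma N_metric: "Metric_space (carrier N) (cdist N)"
proof
  have c: "cdist N x y = (if x \<in> f ` M \<and> y \<in> f ` M then cdist A (inv_into M f x) (inv_into M f y) else 0)"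
    for x y
    using inj N_dist by (auto simp: N_simps(1)) (simp_all add: cdist_def N_simps(1))
  fix x y z
  show "0 \<le> cdist N x y" using Metric_space.nonneg[OF metric] by (simp add: c)
  show "cdist N x y = cdist N y x" using Metric_space.commute[OF metric] by (simp add: c)
  assume "x \<in> carrier N" "y \<in> carrier N"
  then obtain a b where ab: "x = f a" "a \<in> M" "y = f b" "b \<in> M" by (auto simp: N_simps)
  show "cdist N x y = 0 \<longleftrightarrow> x = y"
    using ab Metric_space.zero[OF metric] by (simp add: N_dist MA N_eq)
  assume "z \<in> carrier N"
  then obtain d where "z = f d" "d \<in> M" by (auto simp: N_simps)
  then show "cdist N x z \<le> cdist N x y + cdist N y z"
    using ab Metric_space.triangle[OF metric] by (simp add: N_dist MA)
qed

lemma N_complete: "Metric_space.mcomplete (carrier N) (cdist N)"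
proof -
  interpret a: Metric_space "carrier A" "cdist A" by (rule metric)
  interpret n: Metric_space "carrier N" "cdist N" by (rule N_metric)
  show ?thesis unfolding n.mcomplete_def
  proof (intro allI impI)
    fix \<sigma> assume s: "n.MCauchy \<sigma>"
    then have "range \<sigma> \<subseteq> carrier N" by (simp only: n.MCauchy_def)
    then have "range \<sigma> \<subseteq> f ` M" by (simp only: N_simps(1))
    then have "\<forall>k. \<exists>x\<in>M. \<sigma> k = f x" by blast
    then obtain \<tau> where t: "\<And>k. \<tau> k \<in> M" "\<And>k. \<sigma> k = f (\<tau> k)" by metis
    have "a.MCauchy \<tau>" using s t by (auto simp: n.MCauchy_def a.MCauchy_def N_dist MA)
    then obtain x where x: "limitin a.mtopology \<tau> x sequentially"
      using complete by (auto simp: a.mcomplete_def)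
    have "x \<in> M"
    proof (rule limitin_closedin[OF x])
      show "closedin a.mtopology M" using M by (simp add: cstar_subalgebra_def)
    qed (auto simp: t)
    then have "limitin n.mtopology \<sigma> (f x) sequentially"
      unfolding n.limitin_metric using x t by (simp add: a.limitin_metric N_simps N_dist MA)
    then show "\<exists>x. limitin n.mtopology \<sigma> x sequentially" by blast
  qed
qed

lemma N_cstar: "cstar_algebra N"
proof (intro cstar_algebra.intro cstar_algebra_axioms.intro N_group N_complete)
qed (auto simp: N_simps M_closed N_eq MA smult_l_distr smult_r_distr smult_assoc smult_one
        m_assoc l_distr r_distr smult_m_left smult_m_right star_star star_add star_smult star_mult
        cnorm_nonneg cnorm_eq_0 cnorm_smult cnorm_triangle cnorm_mult cstar_identity)

lemma N_finsum:
  assumes "finite F" "\<And>i. i \<in> F \<Longrightarrow> u i \<in> M"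
  shows "finsum A u F \<in> M \<and> (\<Oplus>\<^bsub>N\<^esub>i\<in>F. f (u i)) = f (finsum A u F)"
  using assms
proof (induction F rule: finite_induct)
  case empty
  interpret N: abelian_group N by (rule N_group)
  show ?case by (simp add: N_simps M_closed)
next
  case (insert i F)
  interpret N: abelian_group N by (rule N_group)
  have "finsum A u (insert i F) = u i \<oplus> finsum A u F"
    using insert MA by (intro finsum_insert) auto
  moreover have "(\<Oplus>\<^bsub>N\<^esub>i\<in>insert i F. f (u i)) = f (u i) \<oplus>\<^bsub>N\<^esub> (\<Oplus>\<^bsub>N\<^esub>i\<in>F. f (u i))"
    using insert by (intro N.finsum_insert) (auto simp: N_simps)
  ultimately show ?case using insert by (simp add: N_simps M_closed)
qed

lemma N_hom: "star_hom N A (inv_into M f)"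
  unfolding star_hom_def using inj
  by (auto simp: N_simps M_closed MA)

end

end

lemma star_hom_comp:
  "\<lbrakk>star_hom A B \<phi>; star_hom B C \<psi>\<rbrakk> \<Longrightarrow> star_hom A C (\<psi> \<circ> \<phi>)"
  unfolding star_hom_def by (auto simp: Pi_iff)

theorem universal_representation_lift:
  fixes C :: "'c cstar" and A :: "'a cstar"
    and \<theta> :: "'l \<Rightarrow> 'b::generalized_boolean_algebra \<Rightarrow> 'b"
  assumes sys: "generalized_boolean_dynamical_system L \<theta> I"
    and U: "universal_representation L \<theta> I A p s"
    and C: "cstar_algebra C" and R: "representation L \<theta> I C P S"
  shows "\<exists>\<phi>. star_hom A C \<phi> \<and> (\<forall>B. \<phi> (p B) = P B) \<and>
             (\<forall>\<alpha>\<in>L. \<forall>B\<in>I \<alpha>. \<phi> (s \<alpha> B) = S \<alpha> B)"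
proof -
  interpret C: cstar_algebra C by (rule C)
  define g where "g = (\<lambda>i. case i of Inl B \<Rightarrow> P B
    | Inr (\<alpha>, B) \<Rightarrow> if \<alpha> \<in> L \<and> B \<in> I \<alpha> then S \<alpha> B else \<zero>\<^bsub>C\<^esub>)"
  have "g i \<in> carrier C" for i
    using R by (auto simp: g_def representation_def projection_def partial_isometry_def
        split: sum.split)
  then obtain M and f :: "'c \<Rightarrow> ('l, 'b) test_elem"
    where M: "cstar_subalgebra C M" and g: "range g \<subseteq> M" and f: "inj_on f M"
    using C.small_subalgebra[of g] by blast
  have P: "P B \<in> M" for B using g[THEN subsetD, OF rangeI, of "Inl B"] by (simp add: g_def)
  have S: "S \<alpha> B \<in> M" if "\<alpha> \<in> L" "B \<in> I \<alpha>" for \<alpha> B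
    using g[THEN subsetD, OF rangeI, of "Inr (\<alpha>, B)"] that by (simp add: g_def)
  let ?N = "transport C M f"
  note simps = C.N_simps[OF M f] C.M_closed[OF M f] C.N_eq[OF M f] C.MA[OF M f]
    C.M_minus[OF M f] C.N_minus[OF M f]
  have in_I: "\<theta> \<alpha> B \<in> I \<alpha>" if "\<alpha> \<in> L" for \<alpha> B
    using generalized_boolean_dynamical_system.range_subset[OF sys that] by blast
  have "representation L \<theta> I ?N (\<lambda>B. f (P B)) (\<lambda>\<alpha> B. f (S \<alpha> B))"
    unfolding representation_def
  proof (intro conjI allI ballI impI)
    fix B assume reg: "regular L \<theta> B"
    let ?u = "\<lambda>\<alpha>. S \<alpha> (\<theta> \<alpha> B) \<otimes>\<^bsub>C\<^esub> star C (S \<alpha> (\<theta> \<alpha> B))"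
    have sub: "out_labels L \<theta> B \<subseteq> L" by (auto simp: out_labels_def)
    have fin: "finite (out_labels L \<theta> B)"
    proof (cases "B = bot")
      case True
      then have "out_labels L \<theta> B = {}"
        using boolean_dynamical_system.action[OF generalized_boolean_dynamical_system.axioms(1)[OF sys]]
        by (auto simp: out_labels_def boolean_action_def)
      then show ?thesis by simp
    qed (use reg in \<open>auto simp: regular_def\<close>)
    have u: "?u \<alpha> \<in> M" if "\<alpha> \<in> out_labels L \<theta> B" for \<alpha>
      using that sub S in_I C.M_closed[OF M f] by (meson subsetD)
    have "P B = finsum C ?u (out_labels L \<theta> B)"
      using R reg by (auto simp: representation_def)
    then have "f (P B) = (\<Oplus>\<^bsub>?N\<^esub>\<alpha>\<in>out_labels L \<theta> B. f (?u \<alpha>))"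
      using C.N_finsum[OF M f fin u] by simp
    also have "\<dots> = (\<Oplus>\<^bsub>?N\<^esub>\<alpha>\<in>out_labels L \<theta> B. f (S \<alpha> (\<theta> \<alpha> B)) \<otimes>\<^bsub>?N\<^esub> star ?N (f (S \<alpha> (\<theta> \<alpha> B))))"
    proof -
      interpret N: abelian_group ?N by (rule C.N_group[OF M f])
      show ?thesis
        by (rule N.finsum_cong') (use sub S in_I in \<open>auto simp: simps subset_iff\<close>)
    qed
    finally show "f (P B) = \<dots>" .
  qed (use R P S in \<open>auto simp: representation_def projection_def partial_isometry_def simps\<close>)
  then have "\<exists>\<phi>. star_hom A ?N \<phi> \<and> (\<forall>B. \<phi> (p B) = f (P B)) \<and>
      (\<forall>\<alpha>\<in>L. \<forall>B\<in>I \<alpha>. \<phi> (s \<alpha> B) = f (S \<alpha> B))"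
    by (intro U[unfolded universal_representation_def, THEN conjunct2, THEN conjunct2,
          THEN conjunct2, THEN spec, THEN spec, THEN spec, THEN mp] conjI C.N_cstar[OF M f])
  then obtain \<phi> where \<phi>: "star_hom A ?N \<phi>" "\<And>B. \<phi> (p B) = f (P B)"
    "\<And>\<alpha> B. \<lbrakk>\<alpha> \<in> L; B \<in> I \<alpha>\<rbrakk> \<Longrightarrow> \<phi> (s \<alpha> B) = f (S \<alpha> B)"
    by blast
  show ?thesis
  proof (intro exI conjI)
    show "star_hom A C (inv_into M f \<circ> \<phi>)"
      using star_hom_comp \<phi>(1) C.N_hom[OF M f] by blast
  qed (use \<phi> P S f in auto)
qed
end

theory Submission
  imports Defs
begin

text \<open>The three conclusions all follow once the given generators of \<open>M\<close> are known to commute with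
  one another. They form a set \<open>X\<close> closed under the involution, so the commutant of \<open>X\<close> is a
  C*-subalgebra containing \<open>X\<close>, hence \<open>M\<close>; the commutant of \<open>M\<close> is then a C*-subalgebra
  containing \<open>X\<close> as well, so \<open>M\<close> is commutative. The diagonal projections belong to \<open>X\<close>, which gives
  \<open>D \<subseteq> M\<close>, and \<open>M \<subseteq> D'\<close> is then a consequence of commutativity.

  Every generator has the form \<open>s\<^sub>\<beta>\<^sub>,\<^sub>B u s\<^sub>\<beta>\<^sub>,\<^sub>B\<^sup>*\<close> where \<open>u\<close> is \<open>p\<^sub>B\<close>, or \<open>s\<^sub>\<gamma>\<^sub>,\<^sub>B\<close> or its adjoint for
  a cycle \<open>(\<gamma>, B)\<close> without exits. Two such elements with incomparable words \<open>\<beta>\<close> and \<open>\<mu>\<close> multiply to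
  \<open>0\<close> in both orders. If \<open>\<mu> = \<beta>\<delta>\<close>, the first element can be moved past \<open>s\<^sub>\<mu>\<^sub>,\<^sub>C\<close> at the price of
  replacing its middle factor \<open>u\<close> by an element \<open>u'\<close> of the same kind attached to a subset of
  \<open>C\<close> (\<open>conjugate_intertwines\<close>). It remains to see that such middle factors commute
  (\<open>loop_elements_commute\<close>).

  Both of these points rest on the fact that the absence of exits leaves only one infinite path
  along which subsets of \<open>B\<close> can travel. Firstly, two loops \<open>\<gamma>\<close> and \<open>\<kappa>\<close> based at the same nonempty
  set satisfy \<open>\<gamma>\<kappa> = \<kappa>\<gamma>\<close>, because both words are the initial segment of this path of the same
  length. Secondly, if \<open>\<theta>\<^sub>\<delta>(B)\<close> is nonempty, then \<open>\<gamma>\<delta> = \<delta>\<rho>\<close> for a rotation \<open>\<rho>\<close> of \<open>\<gamma>\<close>, and \<open>\<rho>\<close> is again a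
  loop without exits at \<open>\<theta>\<^sub>\<delta>(B)\<close> (\<open>exitless_loop_rotate\<close>). As the relation for regular sets makes
  \<open>s\<^sub>\<delta>\<close> a unitary between the corners of \<open>B\<close> and \<open>\<theta>\<^sub>\<delta>(B)\<close>, it carries \<open>s\<^sub>\<gamma>\<close> to \<open>s\<^sub>\<rho>\<close>.\<close>

section \<open>Paths in a Boolean dynamical system\<close>

lemma (in generalized_boolean_algebra) minus_eq_bot_iff: "x - y = bot \<longleftrightarrow> x \<le> y"
proof
  assume "x - y = bot"
  then show "x \<le> y" using sup_minus_eq[of x y] by (metis sup_bot_right inf.absorb_iff1)
next
  assume "x \<le> y"
  then have "inf x (x - y) = bot" using inf_minus_eq_bot[of x y] by (simp add: inf_absorb1)
  moreover have "x - y \<le> x" using sup_minus_eq[of x y] by (metis sup_ge2)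
  ultimately show "x - y = bot" by (simp add: inf_absorb2)
qed

lemma (in generalized_boolean_algebra) minus_le: "x - y \<le> x"
  using sup_minus_eq[of x y] by (metis sup_ge2)

lemma word_action_simps [simp]:
  "word_action \<theta> [] B = B"
  "word_action \<theta> (a # w) B = word_action \<theta> w (\<theta> a B)"
  "word_action \<theta> (v @ w) B = word_action \<theta> w (word_action \<theta> v B)"
  by (simp_all add: word_action_def)

context boolean_dynamical_system
begin

lemma word_action_boolean:
  assumes "w \<in> lists L"
  shows "word_action \<theta> w bot = bot"
    and "word_action \<theta> w (inf B C) = inf (word_action \<theta> w B) (word_action \<theta> w C)"
    and "word_action \<theta> w (B - C) = word_action \<theta> w B - word_action \<theta> w C"
  using assms
  by (induction w arbitrary: B C) (auto dest: action simp: boolean_action_def)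

lemma word_action_mono:
  assumes "w \<in> lists L" "B \<le> C"
  shows "word_action \<theta> w B \<le> word_action \<theta> w C"
  using word_action_boolean(2)[OF assms(1), of B C] assms(2) by (simp add: inf_absorb1 le_iff_inf)

text \<open>Nothing that is reached from \<open>B\<close> ever branches or dies out. This includes regularity: a set all of
  whose nonempty subsets emit exactly one label is regular.\<close>

definition exitless :: "'b \<Rightarrow> bool" where
  "exitless B \<longleftrightarrow> (\<forall>w\<in>lists L. \<exists>a. \<forall>C. C \<noteq> bot \<and> C \<le> word_action \<theta> w B \<longrightarrow>
     out_labels L \<theta> C = {a})"

lemma exitless_subset: "\<lbrakk>exitless B; C \<le> B\<rbrakk> \<Longrightarrow> exitless C"
  unfolding exitless_def by (meson word_action_mono order_trans)

lemma exitless_word_action: "\<lbrakk>exitless B; w \<in> lists L\<rbrakk> \<Longrightarrow> exitless (word_action \<theta> w B)"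
  unfolding exitless_def by (metis append_in_lists_conv word_action_simps(3))

lemma exitless_action: "\<lbrakk>exitless B; a \<in> L\<rbrakk> \<Longrightarrow> exitless (\<theta> a B)"
  using exitless_word_action[of B "[a]"] by simp

lemma exitless_out_labels:
  assumes "exitless B" "a \<in> L" "\<theta> a B \<noteq> bot" "C \<noteq> bot" "C \<le> B"
  shows "out_labels L \<theta> C = {a}"
proof -
  obtain b where b: "\<And>C. C \<noteq> bot \<Longrightarrow> C \<le> B \<Longrightarrow> out_labels L \<theta> C = {b}"
    using assms(1) by (force simp: exitless_def dest: bspec[of _ _ "[]"])
  have "a \<in> out_labels L \<theta> B" using assms by (simp add: out_labels_def)
  moreover have "B \<noteq> bot" using assms(4,5) bot.extremum_uniqueI by blast
  ultimately show ?thesis using b[of B] b[OF assms(4,5)] by simp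
qed

text \<open>A letter that does not kill an exitless \<open>B\<close> is the only label of \<open>B\<close>, and its nonempty subsets have
  the same label. So all of them survive along a path that \<open>B\<close> survives.\<close>

lemma exitless_nonvanishing:
  assumes "exitless B" "w \<in> lists L" "word_action \<theta> w B \<noteq> bot" "C \<noteq> bot" "C \<le> B"
  shows "word_action \<theta> w C \<noteq> bot"
  using assms
proof (induction w arbitrary: B C)
  case (Cons a w)
  have a: "a \<in> L" "w \<in> lists L" using Cons.prems by auto
  have ne: "\<theta> a B \<noteq> bot" using Cons.prems(3) word_action_boolean(1)[OF a(2)] by auto
  have "a \<in> out_labels L \<theta> C"
    using exitless_out_labels[OF Cons.prems(1) a(1) ne Cons.prems(4,5)] by simp
  then have "\<theta> a C \<noteq> bot" by (simp add: out_labels_def)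
  moreover have "\<theta> a C \<le> \<theta> a B"
    using word_action_mono[of "[a]" C B] a Cons.prems(5) by simp
  ultimately show ?case
    using Cons.IH[of "\<theta> a B" "\<theta> a C"] exitless_action[OF Cons.prems(1) a(1)] a Cons.prems(3) by simp
qed simp

text \<open>The action along the path of \<open>B\<close> kills no nonempty difference \<open>C - D\<close>, hence is injective on the
  subsets of \<open>B\<close>. Rotating a loop depends on this.\<close>

lemma exitless_inj:
  assumes B: "exitless B" and w: "w \<in> lists L" "word_action \<theta> w B \<noteq> bot"
    and CD: "C \<le> B" "D \<le> B" and eq: "word_action \<theta> w C = word_action \<theta> w D"
  shows "C = D"
proof -
  have "X \<le> Y" if "X \<le> B" "word_action \<theta> w X = word_action \<theta> w Y" for X Y
  proof -
    have "word_action \<theta> w (X - Y) = bot"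
      using that word_action_boolean(3)[OF w(1)] by (simp add: minus_eq_bot_iff)
    then have "X - Y = bot"
      using exitless_nonvanishing[OF B w, of "X - Y"] that minus_le order_trans by blast
    then show ?thesis by (simp add: minus_eq_bot_iff)
  qed
  then show ?thesis using CD eq by (metis order_antisym)
qed

lemma exitless_unique_path:
  assumes "exitless B" "v \<in> lists L" "w \<in> lists L" "length v = length w"
    and "word_action \<theta> v B \<noteq> bot" "word_action \<theta> w B \<noteq> bot"
  shows "v = w"
  using assms(4,1-3,5-6)
proof (induction v w arbitrary: B rule: list_induct2)
  case (Cons a v b w)
  have ab: "a \<in> L" "v \<in> lists L" "b \<in> L" "w \<in> lists L" using Cons.prems by auto
  have ne: "\<theta> a B \<noteq> bot" "\<theta> b B \<noteq> bot"
    using Cons.prems(4,5) word_action_boolean(1)[OF ab(2)] word_action_boolean(1)[OF ab(4)] by auto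
  have "B \<noteq> bot" using ne(1) action[OF ab(1)] by (auto simp: boolean_action_def)
  then have "a = b"
    using exitless_out_labels[OF Cons.prems(1), of _ B] ab ne by blast
  then show ?case using Cons.IH[of "\<theta> a B"] Cons.prems exitless_action ab by simp
qed simp

text \<open>Cycles without exits, with two degenerate cases added: \<open>B\<close> may be empty and \<open>w\<close> may be the empty
  word. Restricting a loop to any subset then gives a loop again, with no distinction of cases.\<close>

definition exitless_loop :: "'l list \<Rightarrow> 'b \<Rightarrow> bool" where
  "exitless_loop w B \<longleftrightarrow>
     w \<in> lists L \<and> exitless B \<and> (\<forall>C. C \<le> B \<longrightarrow> word_action \<theta> w C = C)"

lemma exitless_loop_subset: "\<lbrakk>exitless_loop w B; C \<le> B\<rbrakk> \<Longrightarrow> exitless_loop w C"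
  unfolding exitless_loop_def using exitless_subset order_trans by blast

text \<open>Along every word, \<open>B\<close> stays inside one of the sets \<open>\<theta>\<^sub>w\<^sub>1\<^sub>\<dots>\<^sub>w\<^sub>t(B)\<close> with \<open>1 \<le> t \<le> n\<close> to which the
  condition on exits applies: a letter other than the expected one leads to the empty set.\<close>

lemma cycle_no_exits_imp_exitless_loop:
  assumes c: "cycle L \<theta> w B" and n: "no_exits L \<theta> w B"
  shows "exitless_loop w B"
proof -
  have w: "w \<in> lists L" "w \<noteq> []" and fixed: "\<And>C. C \<le> B \<Longrightarrow> word_action \<theta> w C = C"
    using c by (auto simp: cycle_def)
  have out: "out_labels L \<theta> C = {w ! (t mod length w)}"
    if "t \<in> {1..length w}" "C \<noteq> bot" "C \<le> word_action \<theta> (take t w) B" for t C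
    using n that by (auto simp: no_exits_def)
  have step: "\<exists>t\<in>{1..length w}. word_action \<theta> v B \<le> word_action \<theta> (take t w) B"
    if "v \<in> lists L" for v
    using that
  proof (induction v rule: rev_induct)
    case Nil
    show ?case using w fixed by (intro bexI[of _ "length w"]) (auto simp: Suc_leI)
  next
    case (snoc a v)
    then obtain t where t: "t \<in> {1..length w}"
      "word_action \<theta> v B \<le> word_action \<theta> (take t w) B" by auto
    have a: "a \<in> L" using snoc.prems by simp
    show ?case
    proof (cases "\<theta> a (word_action \<theta> v B) = bot")
      case True
      then show ?thesis using t(1) by auto
    next
      case False
      then have "word_action \<theta> v B \<noteq> bot"
        using action[OF a] by (auto simp: boolean_action_def)
      then have "out_labels L \<theta> (word_action \<theta> v B) = {w ! (t mod length w)}"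
        using out t by blast
      moreover have "a \<in> out_labels L \<theta> (word_action \<theta> v B)"
        using a False by (simp add: out_labels_def)
      ultimately have a_eq: "a = w ! (t mod length w)" by simp
      have mono: "\<theta> a C \<le> \<theta> a D" if "C \<le> D" for C D
        using word_action_mono[of "[a]" C D] a that by simp
      show ?thesis
      proof (cases "t < length w")
        case True
        then have "take (Suc t) w = take t w @ [a]"
          using a_eq by (simp add: take_Suc_conv_app_nth)
        then show ?thesis
          using True mono[OF t(2)] by (intro bexI[of _ "Suc t"]) auto
      next
        case False
        then have "t = length w" using t(1) by simp
        \<comment> \<open>At the end of the cycle the path is back inside \<open>B\<close> and continues with the first letter.\<close>
        then have "take 1 w = [a]" "word_action \<theta> v B \<le> B"
          using a_eq w t(2) fixed[of B] by (auto simp: take_Suc hd_conv_nth)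
        then show ?thesis
          using mono[of "word_action \<theta> v B" B] w by (intro bexI[of _ 1]) (auto simp: Suc_leI)
      qed
    qed
  qed
  have "exitless B" unfolding exitless_def
    using step out by (meson order_trans)
  then show ?thesis using w fixed by (simp add: exitless_loop_def)
qed

text \<open>For \<open>C \<subseteq> \<theta>\<^sub>a(B)\<close> the set \<open>\<theta>\<^sub>w(C)\<close> lies in \<open>B\<close> and is fixed by \<open>aw\<close>. So \<open>\<theta>\<^sub>w\<close> takes the same value at
  \<open>\<theta>\<^sub>a(\<theta>\<^sub>w(C))\<close> and at \<open>C\<close>, and it is injective on subsets of \<open>\<theta>\<^sub>a(B)\<close>. For a cycle with exits this
  step can fail, because \<open>C\<close> need not be in the range of \<open>\<theta>\<^sub>a\<close>.\<close>

lemma exitless_loop_rotate1: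
  assumes l: "exitless_loop (a # w) B"
  shows "exitless_loop (w @ [a]) (\<theta> a B)"
proof (cases "\<theta> a B = bot")
  case True
  have "w @ [a] \<in> lists L" using l by (auto simp: exitless_loop_def)
  moreover have "exitless (\<theta> a B)" using l exitless_action by (auto simp: exitless_loop_def)
  ultimately show ?thesis
    using True word_action_boolean(1)[of "w @ [a]"] bot.extremum_uniqueI
    unfolding exitless_loop_def by metis
next
  case False
  have a: "a \<in> L" "w \<in> lists L" and B: "exitless B"
    and fixed: "\<And>C. C \<le> B \<Longrightarrow> word_action \<theta> w (\<theta> a C) = C"
    using l by (auto simp: exitless_loop_def)
  have ex: "exitless (\<theta> a B)" using exitless_action a B by simp
  have ne: "word_action \<theta> w (\<theta> a B) \<noteq> bot"
    using False fixed[of B] action[OF a(1)] by (auto simp: boolean_action_def)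
  have "\<theta> a (word_action \<theta> w C) = C" if "C \<le> \<theta> a B" for C
  proof (rule exitless_inj[OF ex a(2) ne _ that])
    have le: "word_action \<theta> w C \<le> B"
      using word_action_mono[OF a(2) that] fixed[of B] by simp
    show "\<theta> a (word_action \<theta> w C) \<le> \<theta> a B"
      using word_action_mono[of "[a]", OF _ le] a by simp
    show "word_action \<theta> w (\<theta> a (word_action \<theta> w C)) = word_action \<theta> w C"
      by (rule fixed[OF le])
  qed
  then show ?thesis using a ex by (simp add: exitless_loop_def)
qed

lemma exitless_loop_rotate:
  assumes "exitless_loop w B" "w \<noteq> []" "v \<in> lists L" "word_action \<theta> v B \<noteq> bot"
  shows "\<exists>u. w @ v = v @ u \<and> exitless_loop u (word_action \<theta> v B)"
  using assms
proof (induction v arbitrary: w B)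
  case (Cons b v)
  obtain a w' where w: "w = a # w'" using Cons.prems(2) by (cases w) auto
  have ab: "a \<in> L" "b \<in> L" "w' \<in> lists L" "v \<in> lists L" and B: "exitless B"
    and fixed: "word_action \<theta> w' (\<theta> a B) = B"
    using Cons.prems w by (auto simp: exitless_loop_def)
  have b: "\<theta> b B \<noteq> bot" using Cons.prems(4) word_action_boolean(1)[OF ab(4)] by auto
  then have B0: "B \<noteq> bot" using action[OF ab(2)] by (auto simp: boolean_action_def)
  then have "\<theta> a B \<noteq> bot" using fixed word_action_boolean(1)[OF ab(3)] by auto
  then have "a = b" using exitless_out_labels[OF B, of _ B] ab b B0 by blast
  moreover have "exitless_loop (w' @ [a]) (\<theta> a B)"
    using exitless_loop_rotate1 Cons.prems(1) w by blast
  ultimately show ?case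
    using Cons.IH[of "w' @ [a]" "\<theta> a B"] Cons.prems w by auto
qed simp

lemma exitless_loop_commute:
  assumes v: "exitless_loop v B" and w: "exitless_loop w B" and "B \<noteq> bot"
  shows "v @ w = w @ v"
  by (rule exitless_unique_path[of B]) (use assms in \<open>auto simp: exitless_loop_def\<close>)

end

section \<open>Commutants in C*-algebras\<close>

context cstar_algebra
begin

lemma minus_mult:
  assumes "x \<in> carrier A" "y \<in> carrier A" "z \<in> carrier A"
  shows "(x \<ominus> y) \<otimes> z = x \<otimes> z \<ominus> y \<otimes> z" "z \<otimes> (x \<ominus> y) = z \<otimes> x \<ominus> z \<otimes> y"
  using assms
  by (simp_all add: minus_smult l_distr r_distr smult_closed m_closed smult_m_left smult_m_right)

lemma mult_zero:
  assumes "x \<in> carrier A"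
  shows "\<zero> \<otimes> x = \<zero>" "x \<otimes> \<zero> = \<zero>"
  using assms smult_zero[of \<zero>] smult_m_left[of \<zero> x 0] smult_m_right[of x \<zero> 0]
  by (simp_all add: smult_zero m_closed)

lemma star_zero: "star A \<zero> = \<zero>"
  using star_smult[of \<zero> 0] smult_zero[of \<zero>] smult_zero[of "star A \<zero>"] by (simp add: star_closed)

lemma star_minus:
  assumes "x \<in> carrier A" "y \<in> carrier A"
  shows "star A (x \<ominus> y) = star A x \<ominus> star A y"
  using assms by (simp add: minus_smult star_add star_smult smult_closed star_closed)

lemma star_mult_eq_zero: 
  assumes "x \<in> carrier A" "star A x \<otimes> x = \<zero>"
  shows "x = \<zero>"
proof -
  have "(cnorm A x)\<^sup>2 = cnorm A \<zero>" using cstar_identity[OF assms(1)] assms(2) by metis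
  then have "cnorm A x = 0" using cnorm_eq_0[OF zero_closed] by simp
  then show ?thesis using cnorm_eq_0[OF assms(1)] by blast
qed

text \<open>The C*-identity for \<open>x - y\<close>. The equations between different expressions for the isometry of a word
  are obtained in this way, since only the products \<open>x\<^sup>*y\<close> are prescribed by the relations.\<close>

lemma eq_if_inner_eq:
  assumes xy: "x \<in> carrier A" "y \<in> carrier A"
    and "star A x \<otimes> x = q" "star A x \<otimes> y = q" "star A y \<otimes> x = q" "star A y \<otimes> y = q"
  shows "x = y"
proof -
  have q: "q \<in> carrier A" using assms by (auto simp: m_closed star_closed)
  have "star A (x \<ominus> y) \<otimes> (x \<ominus> y) = (q \<ominus> q) \<ominus> (q \<ominus> q)"
    using assms by (simp add: star_minus minus_mult star_closed)
  also have "\<dots> = \<zero>" using q by (simp add: minus_eq_zero_iff)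
  finally show ?thesis using star_mult_eq_zero[of "x \<ominus> y"] xy by (simp add: minus_eq_zero_iff)
qed

text \<open>For closedness: if \<open>z\<close> commutes with \<open>y\<close> and approximates \<open>x\<close>, then
  \<open>xy - yx = (x - z)y + y(z - x)\<close> has norm at most \<open>2 \<parallel>x - z\<parallel> \<parallel>y\<parallel>\<close>.\<close>

lemma commutant_subalgebra:
  assumes Y: "Y \<subseteq> carrier A" and st: "\<And>y. y \<in> Y \<Longrightarrow> star A y \<in> Y"
  shows "cstar_subalgebra A {x \<in> carrier A. \<forall>y\<in>Y. x \<otimes> y = y \<otimes> x}" (is "cstar_subalgebra A ?C")
proof -
  have "star A x \<otimes> y = y \<otimes> star A x" if "x \<in> ?C" "y \<in> Y" for x y
  proof -
    have "star A (star A y \<otimes> x) = star A (x \<otimes> star A y)" using that st by auto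
    then show ?thesis using that Y by (auto simp: star_mult star_closed star_star subset_iff)
  qed
  moreover have "(x \<otimes> z) \<otimes> y = y \<otimes> (x \<otimes> z)" if x: "x \<in> ?C" and z: "z \<in> ?C" and y: "y \<in> Y" for x z y
  proof -
    have c: "x \<in> carrier A" "z \<in> carrier A" "y \<in> carrier A" using x z y Y by auto
    have "(x \<otimes> z) \<otimes> y = x \<otimes> (y \<otimes> z)" using z y c by (simp add: m_assoc)
    also have "\<dots> = (x \<otimes> y) \<otimes> z" using c by (simp add: m_assoc)
    also have "\<dots> = y \<otimes> (x \<otimes> z)" using x y c by (simp add: m_assoc)
    finally show ?thesis .
  qed
  moreover have "x \<otimes> y = y \<otimes> x"
    if x: "x \<in> carrier A" and ap: "\<forall>e>0. \<exists>z\<in>?C. cnorm A (x \<ominus> z) < e" and y: "y \<in> Y" for x y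
  proof -
    have c: "y \<in> carrier A" using y Y by auto
    have "cnorm A (x \<otimes> y \<ominus> y \<otimes> x) \<le> 0"
    proof (rule field_le_epsilon)
      fix e :: real assume e: "e > 0"
      \<comment> \<open>The bound below is \<open>2 d (\<parallel>y\<parallel> + 1)\<close>; the \<open>1\<close> avoids division by \<open>0\<close>.\<close>
      define d where "d = e / (2 * (cnorm A y + 1))"
      have n: "cnorm A y \<ge> 0" using cnorm_nonneg c by simp
      then have "d > 0" using e by (simp add: d_def)
      then obtain z where z: "z \<in> carrier A" "z \<otimes> y = y \<otimes> z" "cnorm A (x \<ominus> z) < d"
        using ap y by blast
      have "x \<otimes> y \<ominus> y \<otimes> x = (x \<otimes> y \<ominus> z \<otimes> y) \<oplus> (y \<otimes> z \<ominus> y \<otimes> x)"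
      proof -
        have "(y \<otimes> z \<ominus> y \<otimes> x) \<oplus> (x \<otimes> y \<ominus> y \<otimes> z) = x \<otimes> y \<ominus> y \<otimes> x"
          using x c z(1) by (intro minus_add_cancel m_closed)
        then show ?thesis using x c z(1) by (simp add: z(2) a_comm m_closed)
      qed
      also have "\<dots> = (x \<ominus> z) \<otimes> y \<oplus> y \<otimes> (z \<ominus> x)"
        using x c z(1) by (simp add: minus_mult)
      finally have "cnorm A (x \<otimes> y \<ominus> y \<otimes> x)
          \<le> cnorm A ((x \<ominus> z) \<otimes> y) + cnorm A (y \<otimes> (z \<ominus> x))"
        using cnorm_triangle x c z(1) by (simp add: m_closed)
      also have "\<dots> \<le> cnorm A (x \<ominus> z) * cnorm A y + cnorm A y * cnorm A (x \<ominus> z)"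
        using cnorm_mult[of "x \<ominus> z" y] cnorm_mult[of y "z \<ominus> x"] cnorm_minus_commute[of z x] x c z(1)
        by (intro add_mono) simp_all
      also have "\<dots> \<le> d * (cnorm A y + 1) + (cnorm A y + 1) * d"
        using z(3) n cnorm_nonneg[of "x \<ominus> z"] x z(1) by (intro add_mono mult_mono) auto
      also have "\<dots> = 0 + e"
      proof -
        have "e / (2 * k) * k = e / 2" if "k > 0" for k :: real
          using that by simp
        from this[of "cnorm A y + 1"] have "d * (cnorm A y + 1) = e / 2"
          using n unfolding d_def by linarith
        then show ?thesis by (simp add: mult.commute)
      qed
      finally show "cnorm A (x \<otimes> y \<ominus> y \<otimes> x) \<le> 0 + e" .
    qed
    then have "cnorm A (x \<otimes> y \<ominus> y \<otimes> x) = 0"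
      using cnorm_nonneg[of "x \<otimes> y \<ominus> y \<otimes> x"] x c by (simp add: m_closed)
    then show ?thesis using x c by (simp add: cnorm_eq_0 m_closed minus_eq_zero_iff)
  qed
  ultimately show ?thesis
    unfolding cstar_subalgebra_def closedin_iff using Y
    by (auto simp: subset_iff m_closed star_closed smult_closed l_distr r_distr
        smult_m_left smult_m_right mult_zero)
qed

lemma generated_subset:
  assumes "cstar_subalgebra A M" "X \<subseteq> M"
  shows "cstar_generated A X \<subseteq> M"
  using assms by (auto simp: cstar_generated_def)

lemma subset_generated: "X \<subseteq> cstar_generated A X"
  by (auto simp: cstar_generated_def)

lemma generated_commutative:
  assumes X: "X \<subseteq> carrier A" and st: "\<And>x. x \<in> X \<Longrightarrow> star A x \<in> X"
    and comm: "\<And>x y. \<lbrakk>x \<in> X; y \<in> X\<rbrakk> \<Longrightarrow> x \<otimes> y = y \<otimes> x"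
    and xy: "x \<in> cstar_generated A X" "y \<in> cstar_generated A X"
  shows "x \<otimes> y = y \<otimes> x"
proof -
  let ?M = "cstar_generated A X"
  have M: "cstar_subalgebra A ?M" by (rule cstar_subalgebra_generated[OF X])
  have "?M \<subseteq> {x \<in> carrier A. \<forall>y\<in>X. x \<otimes> y = y \<otimes> x}"
    using X st comm by (intro generated_subset commutant_subalgebra) auto
  then have "X \<subseteq> {x \<in> carrier A. \<forall>y\<in>?M. x \<otimes> y = y \<otimes> x}"
    using X by (auto simp: subset_iff)
  moreover have "cstar_subalgebra A {x \<in> carrier A. \<forall>y\<in>?M. x \<otimes> y = y \<otimes> x}"
    using M by (intro commutant_subalgebra) (auto simp: cstar_subalgebra_def)
  ultimately have "?M \<subseteq> {x \<in> carrier A. \<forall>y\<in>?M. x \<otimes> y = y \<otimes> x}"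
    by (intro generated_subset)
  then show ?thesis using xy by blast
qed

end

section \<open>Isometries of words\<close>

locale system_representation =
  generalized_boolean_dynamical_system L \<theta> I + cstar_algebra A
  for L :: "'l set" and \<theta> :: "'l \<Rightarrow> 'b::generalized_boolean_algebra \<Rightarrow> 'b"
    and I :: "'l \<Rightarrow> 'b set" and A :: "'a cstar" (structure) +
  fixes p :: "'b \<Rightarrow> 'a" and s :: "'l \<Rightarrow> 'b \<Rightarrow> 'a"
  assumes is_representation: "representation L \<theta> I A p s"
begin

lemma p_closed [simp]: "p B \<in> carrier A"
  and star_p [simp]: "star A (p B) = p B"
  and p_bot: "p bot = \<zero>"
  and p_mult [simp]: "p B \<otimes> p C = p (inf B C)"
  using is_representation by (auto simp: representation_def projection_def)

lemma s_closed: "\<lbrakk>a \<in> L; B \<in> I a\<rbrakk> \<Longrightarrow> s a B \<in> carrier A"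
  and p_s: "\<lbrakk>a \<in> L; B \<in> I a\<rbrakk> \<Longrightarrow> p C \<otimes> s a B = s a B \<otimes> p (\<theta> a C)"
  and s_inner: "\<lbrakk>a \<in> L; B \<in> I a; C \<in> I a\<rbrakk> \<Longrightarrow> star A (s a B) \<otimes> s a C = p (inf B C)"
  and s_orthogonal: "\<lbrakk>a \<in> L; B \<in> I a; b \<in> L; C \<in> I b; a \<noteq> b\<rbrakk> \<Longrightarrow> star A (s a B) \<otimes> s b C = \<zero>"
  using is_representation by (auto simp: representation_def partial_isometry_def)

lemma ideal_subset: "\<lbrakk>a \<in> L; B \<in> I a; C \<le> B\<rbrakk> \<Longrightarrow> C \<in> I a"
  using ideal by (auto simp: boolean_ideal_def)

lemma action_ideal: "a \<in> L \<Longrightarrow> \<theta> a B \<in> I a"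
  using range_subset by blast

text \<open>The form in which a known product is used inside a product that is associated to the right.\<close>

lemma mult_subst: "\<lbrakk>x \<otimes> y = z; x \<in> carrier A; y \<in> carrier A; v \<in> carrier A\<rbrakk>
    \<Longrightarrow> x \<otimes> (y \<otimes> v) = z \<otimes> v"
  using m_assoc[of x y v] by simp

lemma p_mult_assoc: "v \<in> carrier A \<Longrightarrow> p B \<otimes> (p C \<otimes> v) = p (inf B C) \<otimes> v"
  by (rule mult_subst) simp_all

lemma s_p:
  assumes "a \<in> L" "B \<in> I a"
  shows "s a B \<otimes> p C = s a (inf B C)"
proof -
  have c: "inf B C \<in> I a" using ideal_subset assms by simp
  note cl = s_closed[OF assms] s_closed[OF assms(1) c]
  note m = mult_subst[OF s_inner[OF assms assms(2)]]
  show ?thesis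
  proof (rule eq_if_inner_eq[where q = "p (inf B C)"])
    show "star A (s a B \<otimes> p C) \<otimes> (s a B \<otimes> p C) = p (inf B C)"
      using cl by (simp add: star_mult m_assoc star_closed m_closed m inf_aci)
    show "star A (s a B \<otimes> p C) \<otimes> s a (inf B C) = p (inf B C)"
      using cl assms c by (simp add: star_mult m_assoc star_closed s_inner inf_aci)
    show "star A (s a (inf B C)) \<otimes> (s a B \<otimes> p C) = p (inf B C)"
      using cl assms c mult_subst[OF s_inner[OF assms(1) c assms(2)]]
      by (simp add: star_closed inf_aci)
    show "star A (s a (inf B C)) \<otimes> s a (inf B C) = p (inf B C)"
      using assms c by (simp add: s_inner)
  qed (use cl in \<open>simp_all add: m_closed\<close>)
qed

text \<open>\<open>B\<close> is an admissible first index in the product that defines \<open>s\<^sub>w\<^sub>,\<^sub>C\<close>.\<close>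

definition starts_at :: "'l list \<Rightarrow> 'b \<Rightarrow> 'b \<Rightarrow> bool" where
  "starts_at w B C \<longleftrightarrow>
     w \<in> lists L \<and> w \<noteq> [] \<and> B \<in> I (hd w) \<and> C \<le> word_action \<theta> (tl w) B"

abbreviation path :: "'b \<Rightarrow> 'l list \<Rightarrow> 'b \<Rightarrow> 'a" where
  "path \<equiv> path_product \<theta> A s"

lemma starts_at_Cons2:
  "starts_at (a # b # w) B C \<longleftrightarrow> a \<in> L \<and> B \<in> I a \<and> starts_at (b # w) (\<theta> b B) C"
  using action_ideal by (auto simp: starts_at_def)

lemma path_closed: "starts_at w B C \<Longrightarrow> path B w C \<in> carrier A"
proof (induction w arbitrary: B)
  case (Cons a w)
  show ?case
  proof (cases w)
    case Nil
    then show ?thesis using Cons.prems ideal_subset by (auto simp: starts_at_def intro: s_closed)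
  next
    case (Cons b w')
    then show ?thesis using Cons.prems Cons.IH by (simp add: starts_at_Cons2 m_closed s_closed)
  qed
qed (simp add: starts_at_def)

lemma p_path: "starts_at w B C \<Longrightarrow> p E \<otimes> path B w C = path B w C \<otimes> p (word_action \<theta> w E)"
proof (induction w arbitrary: B E)
  case (Cons a w)
  show ?case
  proof (cases w)
    case Nil
    then show ?thesis using Cons.prems ideal_subset by (auto simp: starts_at_def intro: p_s)
  next
    case w: (Cons b w')
    then have a: "a \<in> L" "B \<in> I a" and b: "starts_at (b # w') (\<theta> b B) C"
      using Cons.prems by (auto simp: starts_at_Cons2)
    note c = s_closed[OF a] path_closed[OF b]
    have "p E \<otimes> path B (a # w) C = s a B \<otimes> (p (\<theta> a E) \<otimes> path (\<theta> b B) w C)"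
      using c w mult_subst[OF p_s[OF a]] by (simp add: m_assoc)
    then show ?thesis using Cons.IH[of "\<theta> b B" "\<theta> a E"] b c w by (simp add: m_assoc)
  qed
qed (simp add: starts_at_def)

lemma path_inner:
  "\<lbrakk>starts_at w B C; starts_at w B' C'\<rbrakk> \<Longrightarrow> star A (path B w C) \<otimes> path B' w C' = p (inf C C')"
proof (induction w arbitrary: B B')
  case (Cons a w)
  show ?case
  proof (cases w)
    case Nil
    then show ?thesis using Cons.prems ideal_subset by (auto simp: starts_at_def intro: s_inner)
  next
    case w: (Cons b w')
    then have a: "a \<in> L" "B \<in> I a" "B' \<in> I a"
      and b: "starts_at w (\<theta> b B) C" "starts_at w (\<theta> b B') C'"
      using Cons.prems by (auto simp: starts_at_Cons2)
    have bl: "w \<in> lists L" using b by (simp add: starts_at_def)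
    note c = s_closed[OF a(1,2)] s_closed[OF a(1,3)] path_closed[OF b(1)] path_closed[OF b(2)]
    have "star A (path B (a # w) C) \<otimes> path B' (a # w) C'
        = star A (path (\<theta> b B) w C) \<otimes> (p (inf B B') \<otimes> path (\<theta> b B') w C')"
      using c w mult_subst[OF s_inner[OF a]] by (simp add: m_assoc star_mult star_closed m_closed)
    also have "\<dots> = p (inf C C') \<otimes> p (word_action \<theta> w (inf B B'))"
      using c mult_subst[OF Cons.IH[OF b]] by (simp add: p_path[OF b(2)] star_closed)
    also have "\<dots> = p (inf C C')"
    proof -
      have le: "C \<le> word_action \<theta> w B" "C' \<le> word_action \<theta> w B'"
        using b w by (auto simp: starts_at_def)
      have "inf C C' \<le> word_action \<theta> w (inf B B')"
        using le by (simp add: word_action_boolean(2)[OF bl] le_infI1 le_infI2)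
      then show ?thesis by (simp add: inf_absorb1)
    qed
    finally show ?thesis .
  qed
qed (simp add: starts_at_def)

abbreviation iso :: "'l list \<Rightarrow> 'b \<Rightarrow> 'a" where
  "iso \<equiv> word_isometry \<theta> I A p s"

abbreviation dom_ideal :: "'l list \<Rightarrow> 'b set" where
  "dom_ideal \<equiv> word_ideal \<theta> I"

lemma iso_Nil [simp]: "iso [] B = p B"
  by (simp add: word_isometry_def)

text \<open>Any two admissible products have the same inner products \<open>p\<^sub>C\<close> with themselves and with each other,
  so they coincide and the choice of the first index is immaterial.\<close>

lemma iso_eq_path:
  assumes "starts_at w B C"
  shows "iso w C = path B w C"
proof -
  define B' where "B' = (SOME B. B \<in> I (hd w) \<and> C \<le> word_action \<theta> (tl w) B)"
  have "B' \<in> I (hd w) \<and> C \<le> word_action \<theta> (tl w) B'"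
    unfolding B'_def by (rule someI_ex) (use assms in \<open>auto simp: starts_at_def\<close>)
  then have b: "starts_at w B' C" using assms by (simp add: starts_at_def)
  have "path B' w C = path B w C"
    by (rule eq_if_inner_eq[where q = "p C"]) (use path_closed path_inner b assms in simp_all)
  then show ?thesis using assms by (simp add: word_isometry_def B'_def starts_at_def)
qed

lemma iso_Cons:
  assumes "a \<in> L" "w \<in> lists L" "B \<in> I a" "C \<le> word_action \<theta> w B"
  shows "iso (a # w) C = s a B \<otimes> iso w C"
proof -
  have st: "starts_at (a # w) B C" using assms by (simp add: starts_at_def)
  show ?thesis
  proof (cases w)
    case Nil
    then show ?thesis using iso_eq_path[OF st] assms s_p by (simp add: inf_absorb2)
  next
    case (Cons b w')
    then show ?thesis using iso_eq_path[OF st] st iso_eq_path[of w "\<theta> b B" C]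
      by (simp add: starts_at_Cons2)
  qed
qed

lemma dom_ideal_starts_at:
  "\<lbrakk>w \<in> lists L; w \<noteq> []; C \<in> dom_ideal w\<rbrakk> \<Longrightarrow> \<exists>B. starts_at w B C"
  by (cases w) (auto simp: starts_at_def)

lemma dom_ideal_subset: "\<lbrakk>C \<in> dom_ideal w; D \<le> C\<rbrakk> \<Longrightarrow> D \<in> dom_ideal w"
  by (cases w) (auto intro: order_trans)

lemma word_action_dom_ideal: "w \<in> lists L \<Longrightarrow> word_action \<theta> w B \<in> dom_ideal w"
  by (cases w) (auto intro: action_ideal)

lemma dom_ideal_tail: "\<lbrakk>w \<in> lists L; C \<in> dom_ideal (a # w)\<rbrakk> \<Longrightarrow> C \<in> dom_ideal w"
  by (auto intro: dom_ideal_subset word_action_dom_ideal)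

lemma dom_ideal_append:
  "\<lbrakk>w \<in> lists L; B \<in> dom_ideal v; C \<le> word_action \<theta> w B\<rbrakk> \<Longrightarrow> C \<in> dom_ideal (v @ w)"
proof (cases v)
  case (Cons a v')
  assume w: "w \<in> lists L" and B: "B \<in> dom_ideal v" and C: "C \<le> word_action \<theta> w B"
  obtain E where "E \<in> I a" "B \<le> word_action \<theta> v' E" using B Cons by auto
  then show ?thesis using word_action_mono[OF w] C Cons order_trans by fastforce
qed (auto intro: dom_ideal_subset word_action_dom_ideal)

text \<open>The word \<open>v\<close> must be nonempty here: an element of \<open>\<I>\<^sub>w\<close> need not lie below any \<open>\<theta>\<^sub>w(B)\<close>.\<close>

lemma dom_ideal_appendD:
  assumes "v \<in> lists L" "v \<noteq> []" "C \<in> dom_ideal (v @ w)"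
  shows "\<exists>B\<in>dom_ideal v. C \<le> word_action \<theta> w B"
  using assms by (cases v) auto

lemma iso_closed: "\<lbrakk>w \<in> lists L; C \<in> dom_ideal w\<rbrakk> \<Longrightarrow> iso w C \<in> carrier A"
  by (cases "w = []") (use dom_ideal_starts_at iso_eq_path path_closed in fastforce)+

lemma p_iso:
  "\<lbrakk>w \<in> lists L; C \<in> dom_ideal w\<rbrakk> \<Longrightarrow> p E \<otimes> iso w C = iso w C \<otimes> p (word_action \<theta> w E)"
  using dom_ideal_starts_at[of w C] iso_eq_path p_path
  by (cases "w = []") (auto simp: inf_commute)

lemma iso_inner:
  assumes "w \<in> lists L" "C \<in> dom_ideal w" "D \<in> dom_ideal w"
  shows "star A (iso w C) \<otimes> iso w D = p (inf C D)"
proof (cases "w = []")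
  case False
  then obtain B B' where "starts_at w B C" "starts_at w B' D"
    using dom_ideal_starts_at assms by metis
  then show ?thesis using iso_eq_path path_inner by metis
qed simp

lemma iso_p:
  assumes w: "w \<in> lists L" and C: "C \<in> dom_ideal w"
  shows "iso w C \<otimes> p D = iso w (inf C D)"
proof -
  have CD: "inf C D \<in> dom_ideal w" using dom_ideal_subset C by simp
  note c = iso_closed[OF w C] iso_closed[OF w CD]
  note i = iso_inner[OF w] mult_subst[OF iso_inner[OF w]]
  show ?thesis
    by (rule eq_if_inner_eq[where q = "p (inf C D)"])
      (use c C CD in \<open>simp_all add: m_closed star_mult star_closed m_assoc i inf_aci\<close>)
qed

lemma iso_append:
  assumes "v \<in> lists L" "w \<in> lists L" "B \<in> dom_ideal v" "C \<in> dom_ideal w"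
    and "C \<le> word_action \<theta> w B"
  shows "iso v B \<otimes> iso w C = iso (v @ w) C"
  using assms
proof (induction v rule: list.induct)
  case Nil
  then show ?case by (simp add: p_iso iso_p inf_absorb1)
next
  case (Cons a v)
  then have v: "a \<in> L" "v \<in> lists L" by auto
  obtain E where E: "E \<in> I a" "B \<le> word_action \<theta> v E" using Cons.prems by auto
  have B: "B \<in> dom_ideal v" using dom_ideal_tail v Cons.prems by blast
  have C: "C \<le> word_action \<theta> (v @ w) E"
    using word_action_mono[OF Cons.prems(2) E(2)] Cons.prems(5) by (simp add: order_trans)
  have "iso (a # v) B \<otimes> iso w C = s a E \<otimes> (iso v B \<otimes> iso w C)"
    using v E B Cons.prems by (simp add: iso_Cons m_assoc s_closed iso_closed)
  also have "\<dots> = iso (a # v @ w) C"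
    using Cons v E B C by (simp add: iso_Cons)
  finally show ?case by simp
qed

lemma iso_orthogonal:
  assumes "v \<in> lists L" "w \<in> lists L" "B \<in> dom_ideal v" "C \<in> dom_ideal w"
    and "\<nexists>u. w = v @ u" "\<nexists>u. v = w @ u"
  shows "star A (iso v B) \<otimes> iso w C = \<zero>"
  using assms
proof (induction v arbitrary: w rule: list.induct)
  case (Cons a v)
  obtain b w' where w: "w = b # w'" using Cons.prems(6) by (cases w) auto
  have L: "a \<in> L" "v \<in> lists L" "b \<in> L" "w' \<in> lists L" using Cons.prems w by auto
  obtain E where E: "E \<in> I a" "B \<le> word_action \<theta> v E" using Cons.prems by auto
  obtain F where F: "F \<in> I b" "C \<le> word_action \<theta> w' F" using Cons.prems w by auto
  have B: "B \<in> dom_ideal v" "C \<in> dom_ideal w'" using dom_ideal_tail L Cons.prems w by blast+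
  note c = s_closed[OF L(1) E(1)] s_closed[OF L(3) F(1)] iso_closed[OF L(2) B(1)]
    iso_closed[OF L(4) B(2)]
  have eq: "star A (iso (a # v) B) \<otimes> iso w C
      = star A (iso v B) \<otimes> ((star A (s a E) \<otimes> s b F) \<otimes> iso w' C)"
    using L E F c w by (simp add: iso_Cons m_assoc star_mult star_closed m_closed)
  show ?case
  proof (cases "a = b")
    case True
    then have "star A (iso v B) \<otimes> iso w' C = \<zero>"
      using Cons.IH[of w'] Cons.prems w L B by auto
    note z = mult_subst[OF this]
    show ?thesis using eq True c L E F z by (simp add: s_inner p_iso B star_closed mult_zero)
  next
    case False
    then show ?thesis using eq c L E F by (simp add: s_orthogonal mult_zero star_closed)
  qed
qed simp

section \<open>Loops without exits\<close>

text \<open>The relation for regular sets, whose sum has a single term.\<close>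

lemma p_exitless:
  assumes B: "exitless B" and a: "a \<in> L" "\<theta> a B \<noteq> bot"
  shows "s a (\<theta> a B) \<otimes> star A (s a (\<theta> a B)) = p B"
proof -
  note out = exitless_out_labels[OF B a]
  have "B \<noteq> bot" using a action[OF a(1)] by (auto simp: boolean_action_def)
  moreover have "regular L \<theta> B" using out by (auto simp: regular_def)
  ultimately have "p B = (\<Oplus>b\<in>{a}. s b (\<theta> b B) \<otimes> star A (s b (\<theta> b B)))"
    using is_representation out[of B] by (auto simp: representation_def)
  then show ?thesis
    using a s_closed[OF a(1) action_ideal[OF a(1)]] by (simp add: m_closed star_closed)
qed

text \<open>At each letter of the path the whole projection is carried along, because no other label leaves
  the sets on it.\<close>

lemma iso_range_exitless:
  assumes "exitless B" "w \<in> lists L" "word_action \<theta> w B \<noteq> bot"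
  shows "iso w (word_action \<theta> w B) \<otimes> star A (iso w (word_action \<theta> w B)) = p B"
  using assms
proof (induction w arbitrary: B)
  case (Cons a w)
  define C where "C = word_action \<theta> w (\<theta> a B)"
  have L: "a \<in> L" "w \<in> lists L" using Cons.prems by auto
  have ne: "\<theta> a B \<noteq> bot" using Cons.prems(3) word_action_boolean(1)[OF L(2)] by auto
  have id: "\<theta> a B \<in> I a" "C \<in> dom_ideal w"
    using action_ideal word_action_dom_ideal L by (auto simp: C_def)
  note c = s_closed[OF L(1) id(1)] iso_closed[OF L(2) id(2)]
  have IH: "iso w C \<otimes> star A (iso w C) = p (\<theta> a B)"
    using Cons.IH[of "\<theta> a B"] Cons.prems exitless_action L by (simp add: C_def)
  have "iso (a # w) C \<otimes> star A (iso (a # w) C)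
      = s a (\<theta> a B) \<otimes> ((iso w C \<otimes> star A (iso w C)) \<otimes> star A (s a (\<theta> a B)))"
    using L id c iso_Cons[of a w "\<theta> a B" C] by (simp add: C_def m_assoc star_mult star_closed m_closed)
  also have "\<dots> = s a (\<theta> a B) \<otimes> star A (s a (\<theta> a B))"
    using IH c mult_subst[OF s_p[OF L(1) id(1), of "\<theta> a B"]] by (simp add: star_closed)
  finally show ?case using p_exitless[OF Cons.prems(1) L(1) ne] by (simp add: C_def)
qed simp

lemma exitless_loop_dom_ideal: "exitless_loop w B \<Longrightarrow> w \<in> lists L \<and> B \<in> dom_ideal w"
  using word_action_dom_ideal[of w B] by (simp add: exitless_loop_def)

lemma iso_loop_closed: "exitless_loop w B \<Longrightarrow> iso w B \<in> carrier A"
  using exitless_loop_dom_ideal iso_closed by blast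

text \<open>A loop moves no subset of \<open>B\<close>, so its isometry commutes with every projection \<open>p\<^sub>C\<close>.\<close>

lemma iso_loop_p:
  assumes "exitless_loop w B"
  shows "iso w B \<otimes> p C = iso w (inf B C)" "p C \<otimes> iso w B = iso w (inf B C)"
proof -
  note d = exitless_loop_dom_ideal[OF assms]
  show "iso w B \<otimes> p C = iso w (inf B C)" using d iso_p by blast
  have "inf B (word_action \<theta> w C) = inf (word_action \<theta> w B) (word_action \<theta> w C)"
    using assms by (simp add: exitless_loop_def)
  also have "\<dots> = inf B C"
    using assms d word_action_boolean(2)[of w B C] by (simp add: exitless_loop_def)
  finally show "p C \<otimes> iso w B = iso w (inf B C)" using d p_iso iso_p by metis
qed

lemma iso_bot: "\<lbrakk>w \<in> lists L; bot \<in> dom_ideal w\<rbrakk> \<Longrightarrow> iso w bot = \<zero>"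
  using iso_p[of w bot bot] iso_closed[of w bot] by (simp add: p_bot mult_zero)

lemma iso_loop_unitary:
  assumes "exitless_loop w B"
  shows "star A (iso w B) \<otimes> iso w B = p B" "iso w B \<otimes> star A (iso w B) = p B"
proof -
  note d = exitless_loop_dom_ideal[OF assms]
  show "star A (iso w B) \<otimes> iso w B = p B" using iso_inner d by simp
  show "iso w B \<otimes> star A (iso w B) = p B"
  proof (cases "B = bot")
    case True
    then show ?thesis using iso_bot d by (simp add: mult_zero star_zero p_bot)
  next
    case False
    then show ?thesis using iso_range_exitless[of B w] assms by (simp add: exitless_loop_def)
  qed
qed

text \<open>The middle factors of the generators. They live in the corner of \<open>p\<^sub>B\<close>. The projection \<open>p\<^sub>B\<close> is put in
  by hand because \<open>B\<close> itself need not be exitless.\<close>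

definition loop_elements :: "'b \<Rightarrow> 'a set" where
  "loop_elements B = insert (p B) (\<Union>w\<in>{w. exitless_loop w B}. {iso w B, star A (iso w B)})"

lemma loop_elements_cases [consumes 1, case_names p iso star_iso]:
  assumes "u \<in> loop_elements B"
  obtains "u = p B" | w where "exitless_loop w B" "u = iso w B"
    | w where "exitless_loop w B" "u = star A (iso w B)"
  using assms by (auto simp: loop_elements_def)

lemma loop_elements_I:
  "p B \<in> loop_elements B"
  "exitless_loop w B \<Longrightarrow> iso w B \<in> loop_elements B"
  "exitless_loop w B \<Longrightarrow> star A (iso w B) \<in> loop_elements B"
  by (auto simp: loop_elements_def)

lemma loop_elements_closed: "u \<in> loop_elements B \<Longrightarrow> u \<in> carrier A"
  by (cases rule: loop_elements_cases) (auto simp: iso_loop_closed star_closed)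

lemma loop_elements_star: "u \<in> loop_elements B \<Longrightarrow> star A u \<in> loop_elements B"
  by (cases rule: loop_elements_cases)
    (auto simp: iso_loop_closed star_star intro: loop_elements_I)

lemma loop_elements_p:
  assumes "u \<in> loop_elements B"
  shows "u \<otimes> p C \<in> loop_elements (inf B C)" "p C \<otimes> u = u \<otimes> p C"
proof -
  have sub: "exitless_loop w (inf B C)" if "exitless_loop w B" for w
    using exitless_loop_subset[OF that] by simp
  have star: "star A (iso w B) \<otimes> p C = star A (iso w (inf B C))"
    "p C \<otimes> star A (iso w B) = star A (iso w (inf B C))" if "exitless_loop w B" for w
    using iso_loop_p[OF that, of C] star_mult[of "iso w B" "p C"] star_mult[of "p C" "iso w B"]
      iso_loop_closed[OF that] by simp_all
  from assms show "u \<otimes> p C \<in> loop_elements (inf B C)"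
    by (cases rule: loop_elements_cases)
      (auto simp: iso_loop_p star intro: loop_elements_I sub)
  from assms show "p C \<otimes> u = u \<otimes> p C"
    by (cases rule: loop_elements_cases) (auto simp: iso_loop_p star inf_commute)
qed

lemma loop_elements_unit:
  assumes "u \<in> loop_elements B"
  shows "u \<otimes> p B = u" "p B \<otimes> u = u"
proof -
  from assms show "p B \<otimes> u = u"
  proof (cases rule: loop_elements_cases)
    case (star_iso w)
    then show ?thesis
      using star_mult[of "iso w B" "p B"] iso_loop_closed[of w B] iso_loop_p(1)[of w B B] by simp
  qed (auto simp: iso_loop_p)
  then show "u \<otimes> p B = u" using loop_elements_p(2)[OF assms] by simp
qed

text \<open>The two isometries commute because the words do. As they are unitaries in the corner of \<open>p\<^sub>B\<close>,
  each also commutes with the adjoint of the other.\<close>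

lemma iso_loop_commute:
  assumes v: "exitless_loop v B" and w: "exitless_loop w B"
  shows "iso v B \<otimes> iso w B = iso w B \<otimes> iso v B"
    and "iso v B \<otimes> star A (iso w B) = star A (iso w B) \<otimes> iso v B"
proof -
  note d = exitless_loop_dom_ideal[OF v] exitless_loop_dom_ideal[OF w]
  note c = iso_loop_closed[OF v] iso_loop_closed[OF w]
  show comm: "iso v B \<otimes> iso w B = iso w B \<otimes> iso v B"
  proof (cases "B = bot")
    case True
    then show ?thesis using iso_bot d by simp
  next
    case False
    have "iso v B \<otimes> iso w B = iso (v @ w) B" "iso w B \<otimes> iso v B = iso (w @ v) B"
      using iso_append d v w by (simp_all add: exitless_loop_def)
    then show ?thesis using exitless_loop_commute[OF v w False] by simp
  qed
  let ?v = "iso v B" and ?w = "iso w B"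
  note u = loop_elements_unit[OF loop_elements_I(2)[OF v]]
  \<comment> \<open>Insert \<open>p\<^sub>B = w\<^sup>*w\<close> on the left, exchange \<open>w\<close> and \<open>v\<close>, and cancel \<open>ww\<^sup>*\<close> on the right.\<close>
  have "?v \<otimes> star A ?w = (star A ?w \<otimes> ?w) \<otimes> (?v \<otimes> star A ?w)"
    using mult_subst[OF u(2)] c by (simp add: iso_loop_unitary(1)[OF w] star_closed)
  also have "\<dots> = star A ?w \<otimes> ((?w \<otimes> ?v) \<otimes> star A ?w)"
    using c by (simp add: m_assoc star_closed m_closed)
  also have "\<dots> = star A ?w \<otimes> (?v \<otimes> (?w \<otimes> star A ?w))"
    using c by (simp add: m_assoc star_closed m_closed flip: comm)
  also have "\<dots> = star A ?w \<otimes> ?v"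
    by (simp add: iso_loop_unitary(2)[OF w] u)
  finally show "?v \<otimes> star A ?w = star A ?w \<otimes> ?v" .
qed

lemma loop_elements_commute_same:
  assumes u: "u \<in> loop_elements B" and v: "v \<in> loop_elements B"
  shows "u \<otimes> v = v \<otimes> u"
proof -
  have star: "star A (iso x B) \<otimes> star A (iso y B) = star A (iso y B) \<otimes> star A (iso x B)"
    if "exitless_loop x B" "exitless_loop y B" for x y
    using iso_loop_commute(1)[OF that] star_mult iso_loop_closed that by metis
  from u show ?thesis
  proof (cases rule: loop_elements_cases)
    case p
    then show ?thesis using loop_elements_p(2)[OF v] by simp
  next
    case u: (iso x)
    from v show ?thesis
      by (cases rule: loop_elements_cases)
        (use u iso_loop_commute loop_elements_p(2)[OF loop_elements_I(2)] in auto)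
  next
    case u: (star_iso x)
    from v show ?thesis
      by (cases rule: loop_elements_cases)
        (use u star iso_loop_commute loop_elements_p(2)[OF loop_elements_I(3)] in auto)
  qed
qed

text \<open>Only the part over \<open>B \<inter> C\<close> contributes to either product, and both factors restrict to it.\<close>

lemma loop_elements_commute:
  assumes u: "u \<in> loop_elements B" and v: "v \<in> loop_elements C"
  shows "u \<otimes> v = v \<otimes> u"
proof -
  note c = loop_elements_closed[OF u] loop_elements_closed[OF v]
  have uv: "u \<otimes> v = (u \<otimes> p C) \<otimes> (v \<otimes> p B)" "v \<otimes> u = (v \<otimes> p B) \<otimes> (u \<otimes> p C)"
  proof -
    have "u \<otimes> v = (u \<otimes> p B) \<otimes> (p C \<otimes> v)" using loop_elements_unit u v by simp
    also have "\<dots> = u \<otimes> (p C \<otimes> (p B \<otimes> v))" using c by (simp add: m_assoc m_closed p_mult_assoc inf_commute)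
    finally show "u \<otimes> v = (u \<otimes> p C) \<otimes> (v \<otimes> p B)"
      using c loop_elements_p(2)[OF v] by (simp add: m_assoc m_closed)
    have "v \<otimes> u = (v \<otimes> p C) \<otimes> (p B \<otimes> u)" using loop_elements_unit u v by simp
    also have "\<dots> = v \<otimes> (p B \<otimes> (p C \<otimes> u))" using c by (simp add: m_assoc m_closed p_mult_assoc inf_commute)
    finally show "v \<otimes> u = (v \<otimes> p B) \<otimes> (u \<otimes> p C)"
      using c loop_elements_p(2)[OF u] by (simp add: m_assoc m_closed)
  qed
  have "v \<otimes> p B \<in> loop_elements (inf B C)" using loop_elements_p(1)[OF v, of B] by (simp add: inf_commute)
  then show ?thesis
    using loop_elements_commute_same loop_elements_p(1)[OF u, of C] uv by simp
qed

text \<open>With \<open>C = \<theta>\<^sub>w(B)\<close> and the rotation \<open>u\<close> of \<open>v\<close> determined by \<open>vw = wu\<close>: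
  \<open>s\<^sub>v\<^sub>,\<^sub>B = s\<^sub>v\<^sub>,\<^sub>B s\<^sub>w\<^sub>,\<^sub>C s\<^sub>w\<^sub>,\<^sub>C\<^sup>* = s\<^sub>v\<^sub>w\<^sub>,\<^sub>C s\<^sub>w\<^sub>,\<^sub>C\<^sup>* = s\<^sub>w\<^sub>,\<^sub>C s\<^sub>u\<^sub>,\<^sub>C s\<^sub>w\<^sub>,\<^sub>C\<^sup>*\<close>.\<close>

lemma iso_loop_conjugate:
  assumes v: "exitless_loop v B" and w: "w \<in> lists L" "word_action \<theta> w B \<noteq> bot"
  shows "\<exists>u\<in>loop_elements (word_action \<theta> w B).
    iso v B = iso w (word_action \<theta> w B) \<otimes> (u \<otimes> star A (iso w (word_action \<theta> w B)))"
proof -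
  let ?C = "word_action \<theta> w B"
  note dv = exitless_loop_dom_ideal[OF v]
  have B: "exitless B" using v by (simp add: exitless_loop_def)
  have C: "?C \<in> dom_ideal w" using word_action_dom_ideal w by simp
  note c = iso_closed[OF w(1) C] iso_loop_closed[OF v]
  show ?thesis
  proof (cases "v = []")
    case True
    have "iso v B = iso w ?C \<otimes> star A (iso w ?C)"
      using iso_range_exitless[OF B w] True by simp
    also have "\<dots> = iso w ?C \<otimes> (p ?C \<otimes> star A (iso w ?C))"
      using c mult_subst[OF iso_p[OF w(1) C, of ?C]] by (simp add: star_closed)
    finally show ?thesis using loop_elements_I(1) by blast
  next
    case False
    then obtain u where u: "v @ w = w @ u" "exitless_loop u ?C"
      using exitless_loop_rotate[OF v _ w] by blast
    note du = exitless_loop_dom_ideal[OF u(2)]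
    have vC: "?C \<le> word_action \<theta> w B" "?C \<le> word_action \<theta> u ?C"
      using u by (simp_all add: exitless_loop_def)
    have "iso v B = iso v B \<otimes> (iso w ?C \<otimes> star A (iso w ?C))"
      using iso_range_exitless[OF B w] iso_loop_p(1)[OF v, of B] by simp
    also have "\<dots> = iso (v @ w) ?C \<otimes> star A (iso w ?C)"
      using mult_subst[OF iso_append[OF _ w(1) _ C vC(1)]] dv c by (simp add: star_closed)
    also have "\<dots> = (iso w ?C \<otimes> iso u ?C) \<otimes> star A (iso w ?C)"
      using iso_append[OF w(1) _ C _ vC(2)] du u(1) by simp
    also have "\<dots> = iso w ?C \<otimes> (iso u ?C \<otimes> star A (iso w ?C))"
      using c iso_loop_closed[OF u(2)] by (simp add: m_assoc star_closed)
    finally show ?thesis using loop_elements_I(2)[OF u(2)] by blast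
  qed
qed

text \<open>The second equation is the adjoint of the first one for \<open>u\<^sup>*\<close> and \<open>u'\<^sup>*\<close>. Both are needed to move \<open>u\<close>
  past \<open>t y t\<^sup>*\<close> from either side.\<close>

definition intertwines :: "'a \<Rightarrow> 'a \<Rightarrow> 'a \<Rightarrow> bool" where
  "intertwines u t u' \<longleftrightarrow> u \<otimes> t = t \<otimes> u' \<and> star A t \<otimes> u = u' \<otimes> star A t"

lemma intertwines_star:
  assumes "intertwines u t u'" "u \<in> carrier A" "t \<in> carrier A" "u' \<in> carrier A"
  shows "intertwines (star A u) t (star A u')"
proof -
  have "star A (star A t \<otimes> u) = star A (u' \<otimes> star A t)" "star A (u \<otimes> t) = star A (t \<otimes> u')"
    using assms(1) by (simp_all add: intertwines_def)
  then show ?thesis using assms(2-4)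
    by (simp add: intertwines_def star_mult star_star star_closed)
qed

text \<open>If the path \<open>w\<close> kills \<open>B\<close>, all products vanish. Otherwise \<open>s\<^sub>v\<^sub>,\<^sub>B\<close> is conjugate by the isometry of
  \<open>w\<close> to an element \<open>u\<close> of the corner of \<open>\<theta>\<^sub>w(B)\<close>, and the restriction of \<open>u\<close> to \<open>C\<close> intertwines.\<close>

lemma iso_loop_intertwines:
  assumes v: "exitless_loop v B" and w: "w \<in> lists L" and C: "C \<in> dom_ideal w"
  shows "\<exists>u\<in>loop_elements (inf (word_action \<theta> w B) C). intertwines (iso v B) (iso w C) u"
proof -
  let ?F = "word_action \<theta> w B"
  note c = iso_closed[OF w C] iso_loop_closed[OF v]
  have pB: "p B \<otimes> iso w C = iso w (inf ?F C)" using p_iso[OF w C] iso_p[OF w C] by (simp add: inf_commute)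
  have vp: "iso v B \<otimes> p B = iso v B" "p B \<otimes> iso v B = iso v B"
    using loop_elements_unit[OF loop_elements_I(2)[OF v]] by auto
  show ?thesis
  proof (cases "?F = bot")
    case True
    have z: "p B \<otimes> iso w C = \<zero>" using p_iso[OF w C] True c by (simp add: p_bot mult_zero)
    then have "star A (p B \<otimes> iso w C) = \<zero>" by (simp add: star_zero)
    then have z': "star A (iso w C) \<otimes> p B = \<zero>" using c by (simp add: star_mult)
    have "iso v B \<otimes> iso w C = iso v B \<otimes> (p B \<otimes> iso w C)"
      using mult_subst[OF vp(1)] c by simp
    moreover have "star A (iso w C) \<otimes> iso v B = (star A (iso w C) \<otimes> p B) \<otimes> iso v B"
      using vp c by (simp add: m_assoc star_closed)
    ultimately have "intertwines (iso v B) (iso w C) (p bot)"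
      using z z' c by (simp add: intertwines_def p_bot mult_zero star_closed)
    then show ?thesis using True loop_elements_I(1)[of bot] by auto
  next
    case False
    obtain u where u: "u \<in> loop_elements ?F"
      and v_eq: "iso v B = iso w ?F \<otimes> (u \<otimes> star A (iso w ?F))"
      using iso_loop_conjugate[OF v w False] by blast
    have F: "?F \<in> dom_ideal w" using word_action_dom_ideal w by simp
    note c = c iso_closed[OF w F] loop_elements_closed[OF u]
    note up = loop_elements_p(2)[OF u, of C] loop_elements_unit[OF u]
    have Fp: "iso w ?F \<otimes> p C = iso w C \<otimes> p ?F"
      using iso_p[OF w] F C by (simp add: inf_commute)
    then have "star A (iso w ?F \<otimes> p C) = star A (iso w C \<otimes> p ?F)" by simp
    then have Fp': "p C \<otimes> star A (iso w ?F) = p ?F \<otimes> star A (iso w C)"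
      using c by (simp add: star_mult)
    have CF: "p (inf C ?F) = p C \<otimes> p ?F" "p (inf ?F C) = p ?F \<otimes> p C" by simp_all
    have "iso v B \<otimes> iso w C = iso w ?F \<otimes> (u \<otimes> p (inf ?F C))"
      using c F C by (simp add: v_eq m_assoc m_closed star_closed iso_inner[OF w])
    also have "u \<otimes> p (inf ?F C) = p C \<otimes> u"
      using c up mult_subst[OF up(2)] by (simp add: CF del: p_mult)
    also have "iso w ?F \<otimes> (p C \<otimes> u) = iso w C \<otimes> (p ?F \<otimes> u)"
      using c mult_subst[OF Fp] by (simp add: m_assoc)
    also have "\<dots> = iso w C \<otimes> (u \<otimes> p C)"
    proof -
      have "iso w C \<otimes> u = iso w C \<otimes> (p C \<otimes> u)"
        using c mult_subst[OF iso_p[OF w C, of C]] by simp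
      then show ?thesis using up by simp
    qed
    finally have 1: "iso v B \<otimes> iso w C = iso w C \<otimes> (u \<otimes> p C)" .
    have "star A (iso w C) \<otimes> iso v B = p (inf C ?F) \<otimes> (u \<otimes> star A (iso w ?F))"
      using c F C mult_subst[OF iso_inner[OF w C F]] by (simp add: v_eq m_closed star_closed)
    also have "\<dots> = p C \<otimes> (u \<otimes> star A (iso w ?F))"
      using c mult_subst[OF up(3)] by (simp add: CF m_assoc m_closed star_closed del: p_mult)
    also have "\<dots> = u \<otimes> (p C \<otimes> star A (iso w ?F))"
      using c mult_subst[OF up(1)] by (simp add: m_assoc star_closed)
    also have "\<dots> = u \<otimes> star A (iso w C)"
      using c mult_subst[OF up(2)] by (simp add: Fp' star_closed)
    also have "\<dots> = (u \<otimes> p C) \<otimes> star A (iso w C)"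
    proof -
      have "star A (iso w C \<otimes> p C) = star A (iso w C)" using iso_p[OF w C, of C] by simp
      then show ?thesis using c by (simp add: star_mult m_assoc star_closed)
    qed
    finally show ?thesis
      using 1 loop_elements_p(1)[OF u] by (auto simp: intertwines_def)
  qed
qed

lemma loop_elements_intertwines:
  assumes u: "u \<in> loop_elements B" and w: "w \<in> lists L" and C: "C \<in> dom_ideal w"
  shows "\<exists>u'\<in>loop_elements (inf (word_action \<theta> w B) C). intertwines u (iso w C) u'"
  using u
proof (cases rule: loop_elements_cases)
  case p
  have c: "iso w C \<in> carrier A" using iso_closed[OF w C] .
  have e: "p B \<otimes> iso w C = iso w C \<otimes> p (inf (word_action \<theta> w B) C)"
    using p_iso[OF w C] iso_p[OF w C] by (simp add: inf_aci)
  have "star A (iso w C) \<otimes> p B = star A (p B \<otimes> iso w C)"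
    using c by (simp add: star_mult)
  also have "\<dots> = p (inf (word_action \<theta> w B) C) \<otimes> star A (iso w C)"
    unfolding e using c by (simp add: star_mult)
  finally have "intertwines u (iso w C) (p (inf (word_action \<theta> w B) C))"
    using e p by (simp add: intertwines_def)
  then show ?thesis using loop_elements_I(1) by blast
next
  case (iso v)
  then show ?thesis using iso_loop_intertwines[OF _ w C] by simp
next
  case (star_iso v)
  then obtain u' where u': "u' \<in> loop_elements (inf (word_action \<theta> w B) C)"
    "intertwines (iso v B) (iso w C) u'"
    using iso_loop_intertwines[OF _ w C] by blast
  then have "intertwines u (iso w C) (star A u')"
    using star_iso intertwines_star iso_loop_closed iso_closed[OF w C] loop_elements_closed by simp
  then show ?thesis using loop_elements_star u' by blast
qed

section \<open>Commuting generators\<close>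

definition conjugate :: "'l list \<Rightarrow> 'b \<Rightarrow> 'a \<Rightarrow> 'a" where
  "conjugate w B u = iso w B \<otimes> (u \<otimes> star A (iso w B))"

lemma conjugate_closed:
  "\<lbrakk>w \<in> lists L; B \<in> dom_ideal w; u \<in> loop_elements B\<rbrakk> \<Longrightarrow> conjugate w B u \<in> carrier A"
  by (simp add: conjugate_def iso_closed loop_elements_closed m_closed star_closed)

lemma star_conjugate:
  assumes "w \<in> lists L" "B \<in> dom_ideal w" "u \<in> loop_elements B"
  shows "star A (conjugate w B u) = conjugate w B (star A u)"
  using iso_closed[OF assms(1,2)] loop_elements_closed[OF assms(3)]
  by (simp add: conjugate_def star_mult star_star m_closed star_closed m_assoc)

lemma conjugate_iso_append:
  assumes v: "v \<in> lists L" "v \<noteq> []" and w: "w \<in> lists L"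
    and B: "B \<in> dom_ideal v" and C: "C \<in> dom_ideal (v @ w)"
    and u: "u \<in> loop_elements B" and u': "u' \<in> loop_elements (inf (word_action \<theta> w B) C)"
    and i: "u \<otimes> iso w C = iso w C \<otimes> u'"
  shows "conjugate v B u \<otimes> iso (v @ w) C = iso (v @ w) C \<otimes> u'"
proof -
  obtain E where E: "E \<in> dom_ideal v" "C \<le> word_action \<theta> w E"
    using dom_ideal_appendD[OF v C] by blast
  have Cw: "C \<in> dom_ideal w"
    using dom_ideal_subset[OF word_action_dom_ideal[OF w] E(2)] .
  have vw: "iso (v @ w) C = iso v E \<otimes> iso w C"
    using iso_append[OF v(1) w E(1) Cw E(2)] by simp
  note c = iso_closed[OF v(1) B] iso_closed[OF v(1) E(1)] iso_closed[OF w Cw]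
    loop_elements_closed[OF u] loop_elements_closed[OF u']
  have EC: "p E \<otimes> iso w C = iso w C"
    using p_iso[OF w Cw] iso_p[OF w Cw] E(2) by (simp add: inf_absorb1)
  have uE: "u \<otimes> p (inf B E) = u \<otimes> p E"
    using c mult_subst[OF loop_elements_unit(1)[OF u], of "p E"] by (simp flip: p_mult)
  have "conjugate v B u \<otimes> iso (v @ w) C = iso v B \<otimes> ((u \<otimes> p (inf B E)) \<otimes> iso w C)"
    using c mult_subst[OF iso_inner[OF v(1) B E(1)]]
    by (simp add: conjugate_def vw m_assoc m_closed star_closed)
  also have "\<dots> = iso v B \<otimes> ((u \<otimes> p E) \<otimes> iso w C)"
    by (simp only: uE)
  also have "\<dots> = iso v B \<otimes> (p E \<otimes> (iso w C \<otimes> u'))"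
    using c EC i mult_subst[OF EC] by (simp add: m_assoc)
  also have "\<dots> = iso v E \<otimes> (p B \<otimes> (iso w C \<otimes> u'))"
  proof -
    have "iso v B \<otimes> p E = iso v E \<otimes> p B" using iso_p v(1) B E(1) by (simp add: inf_commute)
    then show ?thesis using c mult_subst[of "iso v B" "p E"] by (simp add: m_assoc m_closed)
  qed
  also have "\<dots> = iso v E \<otimes> (iso w C \<otimes> (p (word_action \<theta> w B) \<otimes> u'))"
    using c mult_subst[OF p_iso[OF w Cw]] by (simp add: m_assoc)
  also have "p (word_action \<theta> w B) \<otimes> u' = u'"
  proof -
    have "p (word_action \<theta> w B) \<otimes> (p (inf (word_action \<theta> w B) C) \<otimes> u')
        = p (inf (word_action \<theta> w B) C) \<otimes> u'"
      using c by (simp add: p_mult_assoc inf_aci)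
    then show ?thesis using loop_elements_unit(2)[OF u'] by simp
  qed
  finally show ?thesis using c by (simp add: vw m_assoc)
qed

text \<open>For nonempty \<open>v\<close> the isometry of \<open>vw\<close> factors through that of \<open>v\<close>, which absorbs the outer factors
  of the conjugate and leaves \<open>u\<close> in front of the isometry of \<open>w\<close>. For empty \<open>v\<close> there is no such
  factorisation, but the conjugate is \<open>u\<close> itself.\<close>

lemma conjugate_intertwines:
  assumes v: "v \<in> lists L" and w: "w \<in> lists L"
    and B: "B \<in> dom_ideal v" and C: "C \<in> dom_ideal (v @ w)" and u: "u \<in> loop_elements B"
  shows "\<exists>u'\<in>loop_elements (inf (word_action \<theta> w B) C).
    intertwines (conjugate v B u) (iso (v @ w) C) u'"
proof (cases "v = []")
  case True
  then have "conjugate v B u = u" using loop_elements_unit[OF u] by (simp add: conjugate_def)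
  then show ?thesis using loop_elements_intertwines[OF u w] C True by simp
next
  case False
  obtain E where "E \<in> dom_ideal v" "C \<le> word_action \<theta> w E"
    using dom_ideal_appendD[OF v False C] by blast
  then have Cw: "C \<in> dom_ideal w" using dom_ideal_subset[OF word_action_dom_ideal[OF w]] by blast
  obtain u' where u': "u' \<in> loop_elements (inf (word_action \<theta> w B) C)"
    and i: "intertwines u (iso w C) u'"
    using loop_elements_intertwines[OF u w Cw] by blast
  have "v @ w \<in> lists L" using v w by simp
  note c = iso_closed[OF this C] iso_closed[OF w Cw] loop_elements_closed[OF u]
    loop_elements_closed[OF u'] conjugate_closed[OF v B u]
  have 1: "conjugate v B u \<otimes> iso (v @ w) C = iso (v @ w) C \<otimes> u'"
    using conjugate_iso_append[OF v False w B C u u'] i by (simp add: intertwines_def)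
  have "intertwines (star A u) (iso w C) (star A u')" using intertwines_star[OF i] c by simp
  then have 2: "star A (conjugate v B u) \<otimes> iso (v @ w) C = iso (v @ w) C \<otimes> star A u'"
    using conjugate_iso_append[OF v False w B C loop_elements_star[OF u] loop_elements_star[OF u']]
    by (simp add: intertwines_def star_conjugate[OF v B u])
  have "star A (star A (conjugate v B u) \<otimes> iso (v @ w) C) = star A (iso (v @ w) C \<otimes> star A u')"
    by (simp only: 2)
  then show ?thesis using 1 u' c
    by (auto simp: intertwines_def star_mult star_closed star_star)
qed

lemma conjugate_commute_append:
  assumes v: "v \<in> lists L" and w: "w \<in> lists L"
    and B: "B \<in> dom_ideal v" and C: "C \<in> dom_ideal (v @ w)"
    and x: "x \<in> loop_elements B" and y: "y \<in> loop_elements C"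
  shows "conjugate v B x \<otimes> conjugate (v @ w) C y = conjugate (v @ w) C y \<otimes> conjugate v B x"
proof -
  obtain x' where x': "x' \<in> loop_elements (inf (word_action \<theta> w B) C)"
    and i: "intertwines (conjugate v B x) (iso (v @ w) C) x'"
    using conjugate_intertwines[OF v w B C x] by blast
  have "v @ w \<in> lists L" using v w by simp
  note c = iso_closed[OF this C] loop_elements_closed[OF x'] loop_elements_closed[OF y]
    conjugate_closed[OF v B x]
  let ?t = "iso (v @ w) C"
  have i: "conjugate v B x \<otimes> ?t = ?t \<otimes> x'" "star A ?t \<otimes> conjugate v B x = x' \<otimes> star A ?t"
    using i by (simp_all add: intertwines_def)
  have "conjugate v B x \<otimes> conjugate (v @ w) C y = ?t \<otimes> ((x' \<otimes> y) \<otimes> star A ?t)"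
    unfolding conjugate_def[of "v @ w"]
    using c mult_subst[OF i(1)] by (simp add: m_assoc m_closed star_closed)
  also have "\<dots> = ?t \<otimes> ((y \<otimes> x') \<otimes> star A ?t)"
    using loop_elements_commute[OF x' y] by simp
  also have "\<dots> = conjugate (v @ w) C y \<otimes> conjugate v B x"
    unfolding conjugate_def[of "v @ w"]
    using c i(2) by (simp add: m_assoc m_closed star_closed)
  finally show ?thesis .
qed

lemma conjugate_commute:
  assumes v: "v \<in> lists L" and w: "w \<in> lists L"
    and B: "B \<in> dom_ideal v" and C: "C \<in> dom_ideal w"
    and x: "x \<in> loop_elements B" and y: "y \<in> loop_elements C"
  shows "conjugate v B x \<otimes> conjugate w C y = conjugate w C y \<otimes> conjugate v B x"
proof -
  consider u where "w = v @ u" | u where "v = w @ u" | "\<nexists>u. w = v @ u" "\<nexists>u. v = w @ u" by blast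
  then show ?thesis
  proof cases
    case 1
    then show ?thesis using conjugate_commute_append[of v _ B C x y] assms by auto
  next
    case 2
    then show ?thesis using conjugate_commute_append[of w _ C B y x] assms by auto
  next
    case 3
    note c = iso_closed[OF v B] iso_closed[OF w C] loop_elements_closed[OF x] loop_elements_closed[OF y]
    note z = mult_subst[OF iso_orthogonal[OF v w B C 3]] mult_subst[OF iso_orthogonal[OF w v C B 3(2,1)]]
    show ?thesis
      using c z by (simp add: conjugate_def m_assoc m_closed star_closed mult_zero)
  qed
qed

text \<open>If \<open>v\<close> is a loop at \<open>B\<close>, the isometry of \<open>wv\<close> at \<open>B\<close> factors as \<open>s\<^sub>w\<^sub>,\<^sub>B s\<^sub>v\<^sub>,\<^sub>B\<close> with the same index \<open>B\<close>.\<close>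

lemma standard_generator_eq_conjugate:
  assumes w: "w \<in> lists L" and B: "B \<in> dom_ideal w"
  shows "standard_generator \<theta> I A p s w w B = conjugate w B (p B)"
    and "exitless_loop v B \<Longrightarrow> standard_generator \<theta> I A p s (w @ v) w B = conjugate w B (iso v B)"
    and "exitless_loop v B \<Longrightarrow>
      standard_generator \<theta> I A p s w (w @ v) B = conjugate w B (star A (iso v B))"
proof -
  note c = iso_closed[OF w B]
  have wv: "iso (w @ v) B = iso w B \<otimes> iso v B" if "exitless_loop v B"
    using iso_append[OF w _ B, of v B] exitless_loop_dom_ideal[OF that] that
    by (simp add: exitless_loop_def)
  show "standard_generator \<theta> I A p s w w B = conjugate w B (p B)"
    using mult_subst[OF iso_p[OF w B, of B]] c
    by (simp add: standard_generator_def conjugate_def star_closed)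
  show "standard_generator \<theta> I A p s (w @ v) w B = conjugate w B (iso v B)" if "exitless_loop v B"
    using c iso_loop_closed[OF that]
    by (simp add: standard_generator_def conjugate_def wv[OF that] m_assoc star_closed)
  show "standard_generator \<theta> I A p s w (w @ v) B = conjugate w B (star A (iso v B))"
    if "exitless_loop v B"
    using c iso_loop_closed[OF that]
    by (simp add: standard_generator_def conjugate_def wv[OF that] star_mult)
qed

definition cycle_generators :: "'a set" where
  "cycle_generators = {standard_generator \<theta> I A p s \<alpha> \<beta> B | \<alpha> \<beta> B.
     \<alpha> \<in> lists L \<and> \<beta> \<in> lists L \<and> B \<in> word_ideal \<theta> I \<alpha> \<inter> word_ideal \<theta> I \<beta> \<and>
     (\<alpha> = \<beta> \<or>
      (\<exists>\<gamma>. \<alpha> = \<beta> @ \<gamma> \<and> cycle L \<theta> \<gamma> B \<and> no_exits L \<theta> \<gamma> B) \<or>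
      (\<exists>\<gamma>. \<beta> = \<alpha> @ \<gamma> \<and> cycle L \<theta> \<gamma> B \<and> no_exits L \<theta> \<gamma> B))}"

lemma cycle_generators_conjugate:
  assumes "x \<in> cycle_generators"
  obtains w B u where "w \<in> lists L" "B \<in> dom_ideal w" "u \<in> loop_elements B" "x = conjugate w B u"
proof -
  obtain \<alpha> \<beta> B where x: "x = standard_generator \<theta> I A p s \<alpha> \<beta> B"
    and ab: "\<alpha> \<in> lists L" "\<beta> \<in> lists L" "B \<in> dom_ideal \<alpha>" "B \<in> dom_ideal \<beta>"
    and alt: "\<alpha> = \<beta> \<or> (\<exists>\<gamma>. \<alpha> = \<beta> @ \<gamma> \<and> cycle L \<theta> \<gamma> B \<and> no_exits L \<theta> \<gamma> B) \<or>
      (\<exists>\<gamma>. \<beta> = \<alpha> @ \<gamma> \<and> cycle L \<theta> \<gamma> B \<and> no_exits L \<theta> \<gamma> B)"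
    using assms unfolding cycle_generators_def by blast
  from alt consider "\<alpha> = \<beta>" | \<gamma> where "\<alpha> = \<beta> @ \<gamma>" "exitless_loop \<gamma> B"
    | \<gamma> where "\<beta> = \<alpha> @ \<gamma>" "exitless_loop \<gamma> B"
    using cycle_no_exits_imp_exitless_loop by blast
  then show thesis
    using that ab x standard_generator_eq_conjugate loop_elements_I by cases metis+
qed

lemma cycle_generators_star: "x \<in> cycle_generators \<Longrightarrow> star A x \<in> cycle_generators"
proof -
  assume "x \<in> cycle_generators"
  then obtain \<alpha> \<beta> B where x: "x = standard_generator \<theta> I A p s \<alpha> \<beta> B"
    and ab: "\<alpha> \<in> lists L" "\<beta> \<in> lists L" "B \<in> dom_ideal \<alpha>" "B \<in> dom_ideal \<beta>"
    and alt: "\<alpha> = \<beta> \<or> (\<exists>\<gamma>. \<alpha> = \<beta> @ \<gamma> \<and> cycle L \<theta> \<gamma> B \<and> no_exits L \<theta> \<gamma> B) \<or>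
      (\<exists>\<gamma>. \<beta> = \<alpha> @ \<gamma> \<and> cycle L \<theta> \<gamma> B \<and> no_exits L \<theta> \<gamma> B)"
    unfolding cycle_generators_def by blast
  have "star A x = standard_generator \<theta> I A p s \<beta> \<alpha> B"
    using ab by (simp add: x standard_generator_def star_mult star_star iso_closed star_closed)
  then show ?thesis unfolding cycle_generators_def using ab alt by blast
qed

lemma cycle_generators_subset: "cycle_generators \<subseteq> carrier A"
  by (auto elim!: cycle_generators_conjugate intro: conjugate_closed)

lemma cycle_generators_commute:
  "\<lbrakk>x \<in> cycle_generators; y \<in> cycle_generators\<rbrakk> \<Longrightarrow> x \<otimes> y = y \<otimes> x"
  by (elim cycle_generators_conjugate) (simp add: conjugate_commute)

lemma cycle_subalgebra_eq: "cycle_subalgebra L \<theta> I A p s = cstar_generated A cycle_generators"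
  by (simp add: cycle_subalgebra_def cycle_generators_def)

lemma diagonal_projections_subset: "diagonal_projections L \<theta> I A p s \<subseteq> cycle_generators"
  by (auto simp: diagonal_projections_def cycle_generators_def)

end

theorem proposition4p2:
  fixes L :: "'l set"
    and \<theta> :: "'l \<Rightarrow> 'b::generalized_boolean_algebra \<Rightarrow> 'b"
    and I :: "'l \<Rightarrow> 'b set"
    and A :: "'a cstar"
    and p :: "'b \<Rightarrow> 'a"
    and s :: "'l \<Rightarrow> 'b \<Rightarrow> 'a"
  assumes "generalized_boolean_dynamical_system L \<theta> I"
    and "universal_representation L \<theta> I A p s"
  shows "(\<forall>x\<in>cycle_subalgebra L \<theta> I A p s. \<forall>y\<in>cycle_subalgebra L \<theta> I A p s.
            x \<otimes>\<^bsub>A\<^esub> y = y \<otimes>\<^bsub>A\<^esub> x) \<and>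
         diagonal_subalgebra L \<theta> I A p s \<subseteq> cycle_subalgebra L \<theta> I A p s \<and>
         cycle_subalgebra L \<theta> I A p s \<subseteq> diagonal_commutant L \<theta> I A p s"
proof -
  interpret system_representation L \<theta> I A p s
    using assms
    by (auto simp: system_representation_def system_representation_axioms_def
        universal_representation_def)
  let ?M = "cycle_subalgebra L \<theta> I A p s"
  have M: "cstar_subalgebra A ?M"
    unfolding cycle_subalgebra_eq by (rule cstar_subalgebra_generated[OF cycle_generators_subset])
  have comm: "x \<otimes>\<^bsub>A\<^esub> y = y \<otimes>\<^bsub>A\<^esub> x" if "x \<in> ?M" "y \<in> ?M" for x y
    using generated_commutative[OF cycle_generators_subset cycle_generators_star
        cycle_generators_commute] that
    by (simp add: cycle_subalgebra_eq)
  have diag: "diagonal_projections L \<theta> I A p s \<subseteq> ?M"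
    unfolding cycle_subalgebra_eq using diagonal_projections_subset subset_generated by blast
  have "diagonal_subalgebra L \<theta> I A p s \<subseteq> ?M"
    unfolding diagonal_subalgebra_def by (rule generated_subset[OF M diag])
  moreover have "?M \<subseteq> diagonal_commutant L \<theta> I A p s"
    using M comm diag by (auto simp: diagonal_commutant_def cstar_subalgebra_def)
  ultimately show ?thesis using comm by blast
qed

end
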